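(* Let $f,\mathcal X,\mathcal Y,\ell,D_{\mathcal Y}$ be as in the context and let $\{(x^t,y^t,z^t)\}_{t\ge0}$ be generated by Perturbed Smoothed FOAM, with parameters $r_y^t>0$ and $$\delta^t=O\Big(\frac{(r_y^t)^4D_{\mathcal Y}^2}{\ell^4}\Big),\quad r_x=\Theta(\ell)>3\ell,\quad \beta^t=\Theta(1),\quad 1-\beta^t=\Theta(1)\qquad\text{for all }t\ge0.$$ Let $\Delta_{p_0}=p_0(z^0)-\min_{x\in\mathcal X}\max_{y\in\mathcal Y}f_0(x,y)$ denote the initial gap. For any $\epsilon>0$: (i) (Game stationarity) If $r_y^t=r_y$ for all $t\ge0$ with $r_y=\Theta(\epsilon/D_{\mathcal Y})$, then one can obtain an $\epsilon$-GS of $\min_{x\in\mathcal X}\max_{y\in\mathcal Y}f(x,y)$ after $O\Big(\frac{\ell^{1.5}D_{\mathcal Y}^{0.5}\Delta_{p_0}}{\epsilon^{2.5}}\log\frac1\epsilon\Big)$ gradient steps. (ii) (Optimization stationarity) If $r_y^t=r_y$ for all $t\ge0$ with $r_y=\Theta\big(\epsilon^2/(\ell D_{\mathcal Y}^2)\big)$, then one can obtain an $\epsilon$-OS of $\min_{x\in\mathcal X}\max_{y\in\mathcal Y}f(x,y)$ after $O\Big(\frac{\ell^{2}D_{\mathcal Y}\Delta_{p_0}}{\epsilon^{3}}\log\frac1\epsilon\Big)$ gradient steps.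
   Context: Setting: $f:\mathbb R^n\times\mathbb R^d\to\mathbb R$; $\mathcal X\subseteq\mathbb R^n$ is nonempty, closed and convex; $\mathcal Y\subseteq\mathbb R^d$ is nonempty, compact and convex with $0\in\mathcal Y$ and diameter $D_{\mathcal Y}>0$. The function $f$ is continuously differentiable and $\ell$-smooth ($\ell>0$): for all $x,x'\in\mathcal X$, $y,y'\in\mathcal Y$, both $\|\nabla_xf(x,y)-\nabla_xf(x',y')\|$ and $\|\nabla_yf(x,y)-\nabla_yf(x',y')\|$ are at most $\ell(\|x-x'\|+\|y-y'\|)$. For each $x\in\mathcal X$, $f(x,\cdot)$ is concave. Stationarity: $\iota_S$ is the indicator function of a set $S$ ($0$ on $S$, $+\infty$ outside), and $\partial\iota_S$ its subdifferential. A pair $(x,y)\in\mathcal X\times\mathcal Y$ is an $\epsilon$-game-stationary point ($\epsilon$-GS) if $\mathrm{dist}(0,\nabla_xf(x,y)+\partial\iota_{\mathcal X}(x))\le\epsilon$ and $\mathrm{dist}(0,-\nabla_yf(x,y)+\partial\iota_{\mathcal Y}(y))\le\epsilon$. Let $\Phi(x)=\max_{y'\in\mathcal Y}f(x,y')+\iota_{\mathcal X}(x)$. A point $x\in\mathcal X$ is an $\epsilon$-optimization-stationary point ($\epsilon$-OS) if $\|\mathrm{prox}_{\frac{1}{2\ell}\Phi}(x)-x\|\le\frac{\epsilon}{2\ell}$, where $\mathrm{prox}_{\frac1{2\ell}\Phi}(x)=\arg\min_{w}\{\Phi(w)+\ell\|w-x\|^2\}$. Inner solver FOAM: this is a single-loop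 first-order algorithm from the literature (Kovalev and Gasnikov, 2022) for strongly-convex–strongly-concave saddle-point problems, used as a black box. $\mathrm{FOAM}(h,x^0,y^0,\mu_x,\mu_y,\delta)$ denotes its output on $h$ ($\mu_x$-strongly convex in $x$, $\mu_y$-strongly concave in $y$), initialized at $(x^0,y^0)$. It returns a $\delta$-accurate solution, i.e. $(x,y)$ with $\|x-x^\star\|^2+\|y-y^\star\|^2\le\delta$ where $(x^\star,y^\star)$ is the saddle point of $h$, within $O(\sqrt{\kappa_x\kappa_y}\log(1/\delta))$ iterations (gradient steps), where $\kappa_x,\kappa_y$ are the condition numbers (smoothness constant of the smooth part of $h$ divided by $\mu_x$, resp. $\mu_y$). Perturbed Smoothed FOAM: let $f_t(x,y)=f(x,y)-\frac{r_y^t}{2}\|y\|^2$, $F_t(x,y,z)=f_t(x,y)+\frac{r_x}{2}\|x-z\|^2$ and $p_t(z)=\min_{x\in\mathcal X}\max_{y\in\mathcal Y}F_t(x,y,z)$. From $(x^0,y^0,z^0)$, for $t=0,1,\dots$: set $g_t(x,y)=F_t(x,y,z^t)+\iota_{\mathcal X}(x)-\iota_{\mathcal Y}(y)$, then $$(x^{t+1},y^{t+1})=\mathrm{FOAM}(g_t,x^t,y^t,r_x-\ell,r_y^t,\delta^t),\qquad z^{t+1}=z^t+\beta^t(x^{t+1}-z^t),$$ where $\beta^t\in(0,1)$ and $\delta^t>0$. Conventions: $\epsilon\in(0,1)$ is a sufficiently small positive number; $\Delta_{p_0}$ is understood to be finite. "Gradient steps" counts all inner and outer first-order steps. $O$ and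 $\Theta$ hide positive constants not depending on $\epsilon$, $\ell$, $D_{\mathcal Y}$, $\Delta_{p_0}$ or the iteration index (apart from problem-dependent constants inside logarithms).
   Formalization: Also assumed: log(1/δ^t)=O(log(1/ε)), ε²≤ℓΔ_{p0}, and FOAM outputs lie in X×Y; the upper constant in r_y=Θ(·) is a suitable absolute one; in (i) the ε-GS is one counted projected gradient step from an iterate. *)

theory Defs
  imports "HOL-Analysis.Analysis"
begin

definition nabla :: "('a::real_inner \<Rightarrow> real) \<Rightarrow> 'a \<Rightarrow> 'a" where
  "nabla g x = (THE v. GDERIV g x :> v)"

definition grad_x :: "('a::real_inner \<Rightarrow> 'b::real_inner \<Rightarrow> real) \<Rightarrow> 'a \<Rightarrow> 'b \<Rightarrow> 'a" where
  "grad_x f x y = nabla (\<lambda>u. f u y) x"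

definition grad_y :: "('a::real_inner \<Rightarrow> 'b::real_inner \<Rightarrow> real) \<Rightarrow> 'a \<Rightarrow> 'b \<Rightarrow> 'b" where
  "grad_y f x y = nabla (\<lambda>v. f x v) y"

definition cont_diff :: "('a::real_inner \<Rightarrow> 'b::real_inner \<Rightarrow> real) \<Rightarrow> bool" where
  "cont_diff f \<longleftrightarrow>
     (\<exists>G. (\<forall>p. GDERIV (\<lambda>(x, y). f x y) p :> G p) \<and> continuous_on UNIV G)"

definition smooth_on ::
  "real \<Rightarrow> 'a set \<Rightarrow> 'b set \<Rightarrow> ('a::real_inner \<Rightarrow> 'b::real_inner \<Rightarrow> real) \<Rightarrow> bool" where
  "smooth_on L X Y f \<longleftrightarrow>
     (\<forall>x\<in>X. \<forall>x'\<in>X. \<forall>y\<in>Y. \<forall>y'\<in>Y.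
        norm (grad_x f x y - grad_x f x' y') \<le> L * (norm (x - x') + norm (y - y')) \<and>
        norm (grad_y f x y - grad_y f x' y') \<le> L * (norm (x - x') + norm (y - y')))"

text \<open>The last conjunct says that the infimum of \<open>max\<^sub>y f(\<cdot>, y)\<close> over \<open>X\<close> is finite.  Since \<open>Y\<close> is
  bounded, this is the same as finiteness of the initial gap \<open>\<Delta>\<close> below, for every
  perturbation parameter.\<close>

definition minimax_problem ::
  "('a::euclidean_space \<Rightarrow> 'b::euclidean_space \<Rightarrow> real) \<Rightarrow> 'a set \<Rightarrow> 'b set \<Rightarrow> real \<Rightarrow> bool" where
  "minimax_problem f X Y l \<longleftrightarrow>
     X \<noteq> {} \<and> closed X \<and> convex X \<and>
     Y \<noteq> {} \<and> compact Y \<and> convex Y \<and> 0 \<in> Y \<and> diameter Y > 0 \<and>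
     cont_diff f \<and> l > 0 \<and> smooth_on l X Y f \<and>
     (\<forall>x\<in>X. concave_on Y (\<lambda>y. f x y)) \<and>
     bdd_below ((\<lambda>x. SUP y\<in>Y. f x y) ` X)"

definition ind :: "'a set \<Rightarrow> 'a \<Rightarrow> ereal" where
  "ind S x = (if x \<in> S then 0 else \<infinity>)"

definition subdiff :: "('a::real_inner \<Rightarrow> ereal) \<Rightarrow> 'a \<Rightarrow> 'a set" where
  "subdiff \<phi> x = {v. \<forall>w. \<phi> x + ereal (v \<bullet> (w - x)) \<le> \<phi> w}"

definition game_stationary ::
  "('a::euclidean_space \<Rightarrow> 'b::euclidean_space \<Rightarrow> real) \<Rightarrow> 'a set \<Rightarrow> 'b set \<Rightarrow> real \<Rightarrow> 'a \<times> 'b \<Rightarrow> bool"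
where
  "game_stationary f X Y \<epsilon> = (\<lambda>(x, y). x \<in> X \<and> y \<in> Y \<and>
     infdist 0 ((\<lambda>v. grad_x f x y + v) ` subdiff (ind X) x) \<le> \<epsilon> \<and>
     infdist 0 ((\<lambda>v. - grad_y f x y + v) ` subdiff (ind Y) y) \<le> \<epsilon>)"

definition primal ::
  "('a \<Rightarrow> 'b \<Rightarrow> real) \<Rightarrow> 'a set \<Rightarrow> 'b set \<Rightarrow> 'a \<Rightarrow> ereal" where
  "primal f X Y x = ereal (SUP y\<in>Y. f x y) + ind X x"

definition prox :: "real \<Rightarrow> ('a::real_normed_vector \<Rightarrow> ereal) \<Rightarrow> 'a \<Rightarrow> 'a" where
  "prox c \<phi> x = arg_min (\<lambda>w. \<phi> w + ereal (1 / (2 * c) * (norm (w - x))\<^sup>2)) (\<lambda>_. True)"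

definition opt_stationary ::
  "('a::euclidean_space \<Rightarrow> 'b::euclidean_space \<Rightarrow> real) \<Rightarrow> 'a set \<Rightarrow> 'b set \<Rightarrow> real \<Rightarrow> real \<Rightarrow> 'a \<Rightarrow> bool"
where
  "opt_stationary f X Y l \<epsilon> x \<longleftrightarrow>
     x \<in> X \<and> norm (prox (1 / (2 * l)) (primal f X Y) x - x) \<le> \<epsilon> / (2 * l)"

text \<open>\<open>constrained H X Y\<close> is \<open>H + \<iota>\<^sub>X - \<iota>\<^sub>Y\<close>.  On type \<^typ>\<open>ereal\<close>, \<open>\<infinity> - \<infinity> = \<infinity>\<close>; this only
  concerns points with both \<open>x \<notin> X\<close> and \<open>y \<notin> Y\<close>.  A saddle point of such a function
  always lies in \<open>X \<times> Y\<close> when \<open>X\<close> and \<open>Y\<close> are nonempty.\<close>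

definition constrained ::
  "('a \<Rightarrow> 'b \<Rightarrow> real) \<Rightarrow> 'a set \<Rightarrow> 'b set \<Rightarrow> 'a \<Rightarrow> 'b \<Rightarrow> ereal" where
  "constrained H X Y x y = ereal (H x y) + ind X x - ind Y y"

definition saddle_point :: "('a \<Rightarrow> 'b \<Rightarrow> ereal) \<Rightarrow> 'a \<Rightarrow> 'b \<Rightarrow> bool" where
  "saddle_point h xs ys \<longleftrightarrow> (\<forall>x y. h xs y \<le> h xs ys \<and> h xs ys \<le> h x ys)"

text \<open>A solver \<open>foam\<close> maps \<open>(h, x\<^sup>0, y\<^sup>0, \<mu>\<^sub>x, \<mu>\<^sub>y, \<delta>)\<close> to a feasible point and \<open>steps\<close> gives the number
  of gradient steps it uses.  The guarantee is \<open>\<delta>\<close>-accuracy within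
  \<open>O(\<surd>(\<kappa>\<^sub>x\<kappa>\<^sub>y) log (1/\<delta>))\<close> steps.  The factor next to \<open>1/\<delta>\<close> inside the logarithm is the
  problem-dependent constant: it may involve the condition numbers and the distance of the
  starting point to the saddle point, because no method can be uniform in the starting point when
  \<open>X\<close> is unbounded.  For \<open>K \<ge> 1\<close> a bound \<open>C \<surd>(\<kappa>\<^sub>x\<kappa>\<^sub>y) ln (K/\<delta>)\<close> is a special case.
  The smooth part \<open>H\<close> has smoothness constant \<open>L\<close>, so \<open>\<kappa>\<^sub>x = L/\<mu>\<^sub>x\<close> and \<open>\<kappa>\<^sub>y = L/\<mu>\<^sub>y\<close>.\<close>

definition foam_guarantee ::
  "real \<Rightarrow> real \<Rightarrow>
   (('a::euclidean_space \<Rightarrow> 'b::euclidean_space \<Rightarrow> ereal) \<Rightarrow> 'a \<Rightarrow> 'b \<Rightarrow> real \<Rightarrow> real \<Rightarrow> real \<Rightarrow> 'a \<times> 'b) \<Rightarrow>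
   (('a \<Rightarrow> 'b \<Rightarrow> ereal) \<Rightarrow> 'a \<Rightarrow> 'b \<Rightarrow> real \<Rightarrow> real \<Rightarrow> real \<Rightarrow> nat) \<Rightarrow> bool" where
  "foam_guarantee C K foam steps \<longleftrightarrow>
     (\<forall>H X Y L \<mu>\<^sub>x \<mu>\<^sub>y x\<^sub>0 y\<^sub>0 \<delta>.
        X \<noteq> {} \<and> closed X \<and> convex X \<and> Y \<noteq> {} \<and> closed Y \<and> convex Y \<and>
        cont_diff H \<and> smooth_on L X Y H \<and>
        0 < \<mu>\<^sub>x \<and> \<mu>\<^sub>x \<le> L \<and> 0 < \<mu>\<^sub>y \<and> \<mu>\<^sub>y \<le> L \<and>
        (\<forall>y\<in>Y. convex_on X (\<lambda>x. H x y - \<mu>\<^sub>x / 2 * (norm x)\<^sup>2)) \<and>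
        (\<forall>x\<in>X. concave_on Y (\<lambda>y. H x y + \<mu>\<^sub>y / 2 * (norm y)\<^sup>2)) \<and>
        x\<^sub>0 \<in> X \<and> y\<^sub>0 \<in> Y \<and> 0 < \<delta> \<and> \<delta> < 1
        \<longrightarrow>
        (let h = constrained H X Y;
             (x, y) = foam h x\<^sub>0 y\<^sub>0 \<mu>\<^sub>x \<mu>\<^sub>y \<delta>;
             \<kappa>\<^sub>x = L / \<mu>\<^sub>x; \<kappa>\<^sub>y = L / \<mu>\<^sub>y
         in x \<in> X \<and> y \<in> Y \<and>
            (\<exists>xs ys. saddle_point h xs ys \<and>
               (norm (x - xs))\<^sup>2 + (norm (y - ys))\<^sup>2 \<le> \<delta> \<and>
               real (steps h x\<^sub>0 y\<^sub>0 \<mu>\<^sub>x \<mu>\<^sub>y \<delta>)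
                 \<le> C * sqrt (\<kappa>\<^sub>x * \<kappa>\<^sub>y) *
                   ln (K * \<kappa>\<^sub>x * \<kappa>\<^sub>y * (1 + (norm (x\<^sub>0 - xs))\<^sup>2 + (norm (y\<^sub>0 - ys))\<^sup>2) / \<delta>))))"

text \<open>The argument \<open>r\<close> is the current perturbation parameter \<open>r\<^sub>y\<^sup>t\<close>; the time index enters
  \<open>f\<^sub>t\<close>, \<open>F\<^sub>t\<close>, \<open>p\<^sub>t\<close> and \<open>g\<^sub>t\<close> only through it.\<close>

definition pert :: "real \<Rightarrow> ('a \<Rightarrow> 'b::real_normed_vector \<Rightarrow> real) \<Rightarrow> 'a \<Rightarrow> 'b \<Rightarrow> real" where
  "pert r f x y = f x y - r / 2 * (norm y)\<^sup>2"

definition reg ::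
  "real \<Rightarrow> real \<Rightarrow> ('a::real_normed_vector \<Rightarrow> 'b::real_normed_vector \<Rightarrow> real) \<Rightarrow> 'a \<Rightarrow> 'b \<Rightarrow> 'a \<Rightarrow> real" where
  "reg rx r f x y z = pert r f x y + rx / 2 * (norm (x - z))\<^sup>2"

definition envelope ::
  "real \<Rightarrow> real \<Rightarrow> ('a::real_normed_vector \<Rightarrow> 'b::real_normed_vector \<Rightarrow> real) \<Rightarrow> 'a set \<Rightarrow> 'b set \<Rightarrow> 'a \<Rightarrow> real"
where
  "envelope rx r f X Y z = (INF x\<in>X. SUP y\<in>Y. reg rx r f x y z)"

definition initial_gap ::
  "real \<Rightarrow> real \<Rightarrow> ('a::real_normed_vector \<Rightarrow> 'b::real_normed_vector \<Rightarrow> real) \<Rightarrow> 'a set \<Rightarrow> 'b set \<Rightarrow> 'a \<Rightarrow> real"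
where
  "initial_gap rx r f X Y z\<^sub>0 =
     envelope rx r f X Y z\<^sub>0 - (INF x\<in>X. SUP y\<in>Y. pert r f x y)"

definition subproblem ::
  "real \<Rightarrow> real \<Rightarrow> ('a::real_normed_vector \<Rightarrow> 'b::real_normed_vector \<Rightarrow> real) \<Rightarrow> 'a set \<Rightarrow> 'b set \<Rightarrow> 'a
    \<Rightarrow> 'a \<Rightarrow> 'b \<Rightarrow> ereal" where
  "subproblem rx r f X Y z = constrained (\<lambda>x y. reg rx r f x y z) X Y"

definition psfoam_run where
  "psfoam_run foam f X Y l rx ry \<beta> \<delta> x y z \<longleftrightarrow>
     (\<forall>t::nat.
        (x (Suc t), y (Suc t)) =
          foam (subproblem rx (ry t) f X Y (z t)) (x t) (y t) (rx - l) (ry t) (\<delta> t) \<and>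
        z (Suc t) = z t + \<beta> t *\<^sub>R (x (Suc t) - z t))"

text \<open>Gradient steps used up to iterate \<open>t\<close>: the inner ones, plus one outer step per iteration.\<close>

definition psfoam_steps where
  "psfoam_steps steps f X Y l rx ry \<delta> x y z t =
     (\<Sum>s<t. steps (subproblem rx (ry s) f X Y (z s)) (x s) (y s) (rx - l) (ry s) (\<delta> s) + 1 :: nat)"

text \<open>One projected gradient descent-ascent step.  A point that is merely close to the saddle
  point of the subproblem can have a large distance between \<open>0\<close> and \<open>\<nabla>\<^sub>x f + \<partial>\<iota>\<^sub>X\<close> (the
  solution may lie on the boundary of \<open>X\<close> and the point in the interior), so a game-stationary
  point is read off from an iterate by one such step.\<close>

definition gda_step ::
  "('a::euclidean_space \<Rightarrow> 'b::euclidean_space \<Rightarrow> real) \<Rightarrow> 'a set \<Rightarrow> 'b set \<Rightarrow> real \<Rightarrow> 'a \<times> 'b \<Rightarrow> 'a \<times> 'b" where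
  "gda_step f X Y \<alpha> = (\<lambda>(x, y).
     (closest_point X (x - \<alpha> *\<^sub>R grad_x f x y), closest_point Y (y + \<alpha> *\<^sub>R grad_y f x y)))"

text \<open>The parameter rules, where the constants hidden in the asymptotic notation are \<open>R\<close> for
  \<open>r\<^sub>x\<close>, \<open>b\<close> for \<open>\<beta>\<close> and \<open>1 - \<beta>\<close>, and \<open>a\<close> for \<open>\<delta>\<close>.  An upper bound on \<open>\<delta>\<^sup>t\<close>
  alone does not bound the number of inner steps; the last condition
  \<open>log (1/\<delta>\<^sup>t) = O(log (1/\<epsilon>))\<close> excludes accuracies that are not polynomial in \<open>\<epsilon>\<close>.\<close>

definition admissible_params ::
  "real \<Rightarrow> real \<Rightarrow> real \<Rightarrow> real \<Rightarrow> real \<Rightarrow> real \<Rightarrow> real \<Rightarrow> real \<Rightarrow>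
    (nat \<Rightarrow> real) \<Rightarrow> (nat \<Rightarrow> real) \<Rightarrow> (nat \<Rightarrow> real) \<Rightarrow> bool" where
  "admissible_params R b a q l D \<epsilon> rx ry \<beta> \<delta> \<longleftrightarrow>
     3 * l < rx \<and> rx \<le> R * l \<and>
     (\<forall>t. 0 < ry t \<and> b \<le> \<beta> t \<and> b \<le> 1 - \<beta> t \<and>
          0 < \<delta> t \<and> \<delta> t \<le> a * (ry t ^ 4 * D\<^sup>2 / l ^ 4) \<and>
          ln (1 / \<delta> t) \<le> q * ln (1 / \<epsilon>))"

end

theory Submission
  imports Defs
begin

text \<open>Write \<open>x\<^sup>*(z)\<close> for the minimiser of the proximal problem with centre \<open>z\<close>.  Using
  \<open>x\<^sup>*(z\<^sup>t)\<close> as a trial point for the envelope at \<open>z\<^sup>t\<^sup>+\<^sup>1\<close> shows that the envelope drops by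
  \<open>r\<^sub>x \<beta>\<^sup>t (d\<^sup>2 - \<delta>\<^sup>t) / 2\<close>, where \<open>d\<close> is the distance of \<open>z\<^sup>t\<close> and \<open>x\<^sup>*(z\<^sup>t)\<close>; hence \<open>d\<close> is at most
  of order \<open>\<epsilon> / l\<close> after \<open>O(l \<Delta> / \<epsilon>\<^sup>2)\<close> iterations.  Until then the envelope decreases, so the
  starting points of the inner solver stay within a bounded distance of the saddle points, and every
  inner run costs \<open>O(\<surd>(l / r\<^sub>y) log (1 / \<epsilon>))\<close> steps.  A small \<open>d\<close> gives game stationarity up to
  \<open>r\<^sub>y D\<close> through the optimality conditions of the saddle point, and optimization stationarity up to
  \<open>r\<^sub>y D\<^sup>2\<close> in function value by comparing two strongly convex proximal problems.\<close>

subsection \<open>Convex analysis\<close>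

text \<open>\<open>nabla\<close> is a definite description, so uniqueness of the derivative is what
  lets it be computed.\<close>

lemma nabla_eq:
  assumes "GDERIV g x :> v"
  shows "nabla g x = v"
  unfolding nabla_def
proof (rule the_equality)
  fix w assume "GDERIV g x :> w"
  then have "(\<lambda>h. inner h w) = (\<lambda>h. inner h v)"
    using assms unfolding gderiv_def by (rule has_derivative_unique)
  then show "w = v"
    by (metis inner_commute vector_eq_rdot)
qed fact

lemma cont_diff_partials:
  assumes "cont_diff f"
  shows "GDERIV (\<lambda>u. f u y) x :> grad_x f x y" and "GDERIV (f x) y :> grad_y f x y"
proof -
  from assms obtain G where "GDERIV (\<lambda>(x, y). f x y) (x, y) :> G (x, y)"
    unfolding cont_diff_def by blast
  then have D: "((\<lambda>(x, y). f x y) has_derivative (\<lambda>h. inner h (G (x, y)))) (at (x, y))"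
    by (simp add: gderiv_def)
  have "((\<lambda>u. f u y) has_derivative (\<lambda>h. inner (h, 0) (G (x, y)))) (at x)"
    using has_derivative_compose[OF has_derivative_Pair[OF has_derivative_ident has_derivative_const] D]
    by simp
  then have "GDERIV (\<lambda>u. f u y) x :> fst (G (x, y))"
    by (simp add: gderiv_def inner_prod_def)
  then show "GDERIV (\<lambda>u. f u y) x :> grad_x f x y"
    using nabla_eq unfolding grad_x_def by metis
  have "(f x has_derivative (\<lambda>h. inner (0, h) (G (x, y)))) (at y)"
    using has_derivative_compose[OF has_derivative_Pair[OF has_derivative_const has_derivative_ident] D]
    by simp
  then have "GDERIV (f x) y :> snd (G (x, y))"
    by (simp add: gderiv_def inner_prod_def)
  then show "GDERIV (f x) y :> grad_y f x y"
    using nabla_eq unfolding grad_y_def by (metis (no_types))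
qed

lemma GDERIV_half_norm_sq: "GDERIV (\<lambda>x. c / 2 * (norm (x - z))\<^sup>2) x :> c *\<^sub>R (x - z)"
  unfolding gderiv_def power2_norm_eq_inner
  by (rule derivative_eq_intros refl | simp add: fun_eq_iff inner_commute algebra_simps)+

section \<open>Weak convexity, strong convexity and quadratic growth\<close>

lemma norm_sq_segment:
  fixes a b z :: "'a::real_inner"
  shows "(norm ((1 - t) *\<^sub>R a + t *\<^sub>R b - z))\<^sup>2 =
    (1 - t) * (norm (a - z))\<^sup>2 + t * (norm (b - z))\<^sup>2 - t * (1 - t) * (norm (b - a))\<^sup>2"
  unfolding power2_norm_eq_inner by (simp add: algebra_simps inner_commute)

text \<open>\<open>(norm (x - z))\<^sup>2 - (norm x)\<^sup>2\<close> is affine in \<open>x\<close>,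
  so the centre does not affect convexity and only the total coefficient
  \<open>c / 2 - (c - l) / 2 = l / 2\<close> counts.\<close>

lemma convex_on_recentre_norm_sq:
  fixes g :: "'a::real_inner \<Rightarrow> real"
  assumes "convex_on X (\<lambda>x. g x + l / 2 * (norm x)\<^sup>2)"
  shows "convex_on X (\<lambda>x. g x + c / 2 * (norm (x - z))\<^sup>2 - (c - l) / 2 * (norm x)\<^sup>2)"
proof (rule convex_onI)
  show "convex X" using assms by (rule convex_on_imp_convex)
  fix t :: real and x y assume t: "t > 0" "t < 1" and "x \<in> X" "y \<in> X"
  then have "g ((1 - t) *\<^sub>R x + t *\<^sub>R y) + l / 2 * (norm ((1 - t) *\<^sub>R x + t *\<^sub>R y))\<^sup>2
      \<le> (1 - t) * (g x + l / 2 * (norm x)\<^sup>2) + t * (g y + l / 2 * (norm y)\<^sup>2)"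
    using convex_onD[OF assms, of t x y] by simp
  then show "g ((1 - t) *\<^sub>R x + t *\<^sub>R y) + c / 2 * (norm ((1 - t) *\<^sub>R x + t *\<^sub>R y - z))\<^sup>2
        - (c - l) / 2 * (norm ((1 - t) *\<^sub>R x + t *\<^sub>R y))\<^sup>2
      \<le> (1 - t) * (g x + c / 2 * (norm (x - z))\<^sup>2 - (c - l) / 2 * (norm x)\<^sup>2)
        + t * (g y + c / 2 * (norm (y - z))\<^sup>2 - (c - l) / 2 * (norm y)\<^sup>2)"
    unfolding norm_sq_segment norm_sq_segment[of t x y 0, simplified]
    by (simp add: field_simps)
qed

text \<open>Along a segment the derivative of \<open>g\<close> falls at most at rate
  \<open>l\<close> times the squared length of the segment. The quadratic term raises it at exactly
  that rate, so the sum has a monotone derivative.\<close>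

lemma convex_on_of_lipschitz_gradient:
  fixes g :: "'a::real_inner \<Rightarrow> real"
  assumes "convex X" and D: "\<And>x. GDERIV g x :> g' x"
    and lip: "\<And>x x'. x \<in> X \<Longrightarrow> x' \<in> X \<Longrightarrow> norm (g' x - g' x') \<le> l * norm (x - x')"
  shows "convex_on X (\<lambda>x. g x + l / 2 * (norm x)\<^sup>2)"
proof (rule convex_onI)
  show "convex X" by fact
  fix t :: real and a b assume t: "t > 0" "t < 1" and ab: "a \<in> X" "b \<in> X"
  define p where "p s = (1 - s) *\<^sub>R a + s *\<^sub>R b" for s
  let ?h = "\<lambda>x. g x + l / 2 * (norm x)\<^sup>2"
  have p_in: "p s \<in> X" if "s \<in> {0..1}" for s
    using assms(1) ab that unfolding p_def convex_alt by auto
  have "convex_on {0..1} (\<lambda>s. ?h (p s))"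
  proof (rule convex_on_realI)
    fix s :: real
    have "GDERIV ?h (p s) :> g' (p s) + l *\<^sub>R p s"
      using GDERIV_add[OF D GDERIV_half_norm_sq[where z=0]] by simp
    then have *: "(?h has_derivative (\<lambda>h. inner h (g' (p s) + l *\<^sub>R p s))) (at (p s))"
      by (simp add: gderiv_def)
    have "(p has_derivative (\<lambda>h. h *\<^sub>R (b - a))) (at s)"
      unfolding p_def by (rule derivative_eq_intros refl | simp add: fun_eq_iff algebra_simps)+
    from has_derivative_compose[OF this *]
    show "((\<lambda>s. ?h (p s)) has_real_derivative inner (b - a) (g' (p s) + l *\<^sub>R p s)) (at s)"
      by (simp add: has_field_derivative_def mult_commute_abs)
  next
    fix u v :: real assume uv: "u \<in> {0..1}" "v \<in> {0..1}" "u \<le> v"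
    have pd: "p v - p u = (v - u) *\<^sub>R (b - a)"
      by (simp add: p_def algebra_simps)
    have "norm (g' (p u) - g' (p v)) \<le> l * norm (p v - p u)"
      using lip[OF p_in p_in] uv by (metis norm_minus_commute)
    then have "norm (g' (p u) - g' (p v)) * norm (b - a) \<le> l * ((v - u) * norm (b - a)) * norm (b - a)"
      using uv by (simp add: pd mult_right_mono)
    moreover have "inner (b - a) (g' (p u) - g' (p v)) \<le> norm (g' (p u) - g' (p v)) * norm (b - a)"
      by (metis mult.commute norm_cauchy_schwarz)
    moreover have "inner (b - a) (l *\<^sub>R (p v - p u)) = l * ((v - u) * norm (b - a)) * norm (b - a)"
      by (simp add: pd power2_norm_eq_inner[symmetric] power2_eq_square)
    ultimately have "inner (b - a) (g' (p u) - g' (p v)) \<le> inner (b - a) (l *\<^sub>R (p v - p u))"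
      by linarith
    then show "inner (b - a) (g' (p u) + l *\<^sub>R p u) \<le> inner (b - a) (g' (p v) + l *\<^sub>R p v)"
      by (simp add: inner_diff_right inner_add_right algebra_simps)
  qed simp
  from convex_onD[OF this, of t 0 1] t
  show "?h ((1 - t) *\<^sub>R a + t *\<^sub>R b) \<le> (1 - t) * ?h a + t * ?h b"
    by (simp add: p_def)
qed

text \<open>Moving from \<open>m\<close> a fraction \<open>t\<close> towards \<open>w\<close> cannot
  lower \<open>g\<close>. Strong convexity on the segment, divided by \<open>t\<close>, gives the
  claim up to a factor \<open>1 - t\<close>, and then \<open>t\<close> tends to 0.\<close>

lemma strongly_convex_min:
  fixes g :: "'a::real_inner \<Rightarrow> real"
  assumes conv: "convex_on X (\<lambda>x. g x - \<mu> / 2 * (norm x)\<^sup>2)"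
    and "m \<in> X" "w \<in> X" and min: "\<And>x. x \<in> X \<Longrightarrow> g m \<le> g x"
  shows "g m + \<mu> / 2 * (norm (w - m))\<^sup>2 \<le> g w"
proof -
  have *: "g m + (1 - t) * (\<mu> / 2 * (norm (w - m))\<^sup>2) \<le> g w" if t: "0 < t" "t < 1" for t
  proof -
    let ?p = "(1 - t) *\<^sub>R m + t *\<^sub>R w"
    have "?p \<in> X"
      using convex_on_imp_convex[OF conv] assms(2,3) t unfolding convex_alt by auto
    then have "g m \<le> g ?p" by (rule min)
    moreover have "g ?p - \<mu> / 2 * (norm ?p)\<^sup>2
        \<le> (1 - t) * (g m - \<mu> / 2 * (norm m)\<^sup>2) + t * (g w - \<mu> / 2 * (norm w)\<^sup>2)"
      using convex_onD[OF conv, of t m w] t assms by simp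
    ultimately have "0 \<le> (1 - t) * (g m - \<mu> / 2 * (norm m)\<^sup>2) + t * (g w - \<mu> / 2 * (norm w)\<^sup>2)
        + \<mu> / 2 * (norm ?p)\<^sup>2 - g m" by linarith
    also have "\<dots> = t * (g w - (g m + (1 - t) * (\<mu> / 2 * (norm (w - m))\<^sup>2)))"
      unfolding norm_sq_segment[of t m w 0, simplified] by (simp add: field_simps)
    finally show ?thesis using t by (simp add: zero_le_mult_iff)
  qed
  let ?F = "\<lambda>t. g m + (1 - t) * (\<mu> / 2 * (norm (w - m))\<^sup>2)"
  have "(?F \<longlongrightarrow> ?F 0) (at_right 0)"
    by (intro tendsto_intros)
  moreover have "\<forall>\<^sub>F t in at_right 0. ?F t \<le> g w"
    unfolding eventually_at_right_field by (rule exI[of _ 1]) (use * in auto)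
  ultimately have "?F 0 \<le> g w"
    by (rule tendsto_upperbound) simp
  then show ?thesis by simp
qed

section \<open>First-order optimality, projections, attained minima and normal cones\<close>

lemma first_order_optimality:
  fixes g :: "'a::real_inner \<Rightarrow> real"
  assumes "convex X" "m \<in> X" "w \<in> X" and D: "GDERIV g m :> v"
    and min: "\<And>x. x \<in> X \<Longrightarrow> g m \<le> g x"
  shows "0 \<le> inner v (w - m)"
proof (rule ccontr)
  assume neg: "\<not> ?thesis"
  have "((\<lambda>t. m + t *\<^sub>R (w - m)) has_derivative (\<lambda>t. t *\<^sub>R (w - m))) (at 0)"
    by (rule derivative_eq_intros refl | simp)+
  moreover have "(g has_derivative (\<lambda>h. inner h v)) (at (m + 0 *\<^sub>R (w - m)))"
    using D by (simp add: gderiv_def)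
  ultimately have "((\<lambda>t. g (m + t *\<^sub>R (w - m))) has_real_derivative inner v (w - m)) (at 0)"
    using has_derivative_compose[of "\<lambda>t. m + t *\<^sub>R (w - m)"]
    by (fastforce simp: has_field_derivative_def mult_commute_abs inner_commute)
  from DERIV_neg_dec_right[OF this] neg obtain d where d: "d > 0"
    "\<And>h. 0 < h \<Longrightarrow> h < d \<Longrightarrow> g (m + h *\<^sub>R (w - m)) < g m" by auto
  \<comment> \<open>Shorter than \<open>d\<close> for the decrease, at most 1 to stay on the segment
    inside \<open>X\<close>.\<close>
  define h where "h = min (d / 2) 1"
  have h: "0 < h" "h < d" "h \<le> 1" using d(1) by (auto simp: h_def)
  have "m + h *\<^sub>R (w - m) = (1 - h) *\<^sub>R m + h *\<^sub>R w" by (simp add: algebra_simps)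
  then have "m + h *\<^sub>R (w - m) \<in> X"
    using assms(1-3) h unfolding convex_alt by auto
  with min d(2)[OF h(1,2)] show False by force
qed

text \<open>The inequality puts \<open>- v\<close> in the normal cone at \<open>m\<close>, and
  \<open>m\<close> plus a normal vector projects back to \<open>m\<close>. This makes saddle points
  fixed points of exact projected gradient steps.\<close>

lemma closest_point_variational:
  fixes X :: "'a::euclidean_space set"
  assumes "convex X" "closed X" "m \<in> X" "0 \<le> \<alpha>" and v: "\<And>w. w \<in> X \<Longrightarrow> 0 \<le> inner v (w - m)"
  shows "closest_point X (m - \<alpha> *\<^sub>R v) = m"
proof (rule closest_point_unique[OF assms(1-3), symmetric], intro ballI)
  fix w assume "w \<in> X"
  have "(dist (m - \<alpha> *\<^sub>R v) w)\<^sup>2 = (norm (w - m))\<^sup>2 + 2 * \<alpha> * inner v (w - m) + (dist (m - \<alpha> *\<^sub>R v) m)\<^sup>2"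
    unfolding dist_norm power2_norm_eq_inner by (simp add: algebra_simps inner_commute)
  moreover have "0 \<le> \<alpha> * inner v (w - m)"
    using v[OF \<open>w \<in> X\<close>] \<open>0 \<le> \<alpha>\<close> by simp
  ultimately have "(dist (m - \<alpha> *\<^sub>R v) m)\<^sup>2 \<le> (dist (m - \<alpha> *\<^sub>R v) w)\<^sup>2"
    by simp
  then show "dist (m - \<alpha> *\<^sub>R v) m \<le> dist (m - \<alpha> *\<^sub>R v) w"
    by (rule power2_le_imp_le) simp
qed

text \<open>The sublevel sets at attained values have the finite intersection property, and a common
  point is a minimiser. The form suits suprema of continuous functions, whose sublevel sets are
  intersections of closed sets.\<close>

lemma compact_attains_inf_closed_sublevels:
  fixes \<phi> :: "'a::topological_space \<Rightarrow> real"
  assumes "compact S" "S \<noteq> {}" and cl: "\<And>c. closed {w \<in> S. \<phi> w \<le> c}"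
  shows "\<exists>m\<in>S. \<forall>w\<in>S. \<phi> m \<le> \<phi> w"
proof -
  have "S \<inter> (\<Inter>u\<in>S. {w \<in> S. \<phi> w \<le> \<phi> u}) \<noteq> {}"
  proof (rule compact_imp_fip_image[OF assms(1)])
    fix I assume I: "finite I" "I \<subseteq> S"
    show "S \<inter> (\<Inter>u\<in>I. {w \<in> S. \<phi> w \<le> \<phi> u}) \<noteq> {}"
    proof (cases "I = {}")
      case False
      define m where "m = arg_min_on \<phi> I"
      have "m \<in> I" "\<And>u. u \<in> I \<Longrightarrow> \<phi> m \<le> \<phi> u"
        unfolding m_def using arg_min_if_finite[OF I(1) False, of \<phi>]
        by (auto simp: not_less[symmetric])
      with I have "m \<in> S \<inter> (\<Inter>u\<in>I. {w \<in> S. \<phi> w \<le> \<phi> u})" by auto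
      then show ?thesis by blast
    qed (use assms in simp)
  qed (rule cl)
  then show ?thesis by auto
qed

lemma subdiff_ind_closest_point:
  fixes S :: "'a::euclidean_space set"
  assumes "convex S" "closed S" "S \<noteq> {}"
  shows "a - closest_point S a \<in> subdiff (ind S) (closest_point S a)"
  using closest_point_in_set[OF assms(2,3), of a] closest_point_dot[OF assms(1,2)]
  by (auto simp: subdiff_def ind_def)

text \<open>The subdifferential of an indicator is the normal cone: on \<open>S\<close> the inner
  product is nonpositive and stays so after scaling, off \<open>S\<close> the bound is
  infinite.\<close>

lemma subdiff_ind_scaleR:
  assumes "v \<in> subdiff (ind S) x" "x \<in> S" "0 \<le> k"
  shows "k *\<^sub>R v \<in> subdiff (ind S) x"
  unfolding subdiff_def
proof (intro CollectI allI)
  fix w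
  have "w \<in> S \<Longrightarrow> inner v (w - x) \<le> 0"
    using assms(1,2) by (auto simp: subdiff_def ind_def dest: spec[of _ w])
  then show "ind S x + ereal (inner (k *\<^sub>R v) (w - x)) \<le> ind S w"
    using assms(2,3) by (auto simp: ind_def mult_nonneg_nonpos)
qed

lemma saddle_point_constrainedD:
  assumes sp: "saddle_point (constrained H X Y) xs ys" and "X \<noteq> {}" "Y \<noteq> {}"
  shows "xs \<in> X" "ys \<in> Y"
    and "\<And>y. y \<in> Y \<Longrightarrow> H xs y \<le> H xs ys" "\<And>x. x \<in> X \<Longrightarrow> H xs ys \<le> H x ys"
proof -
  obtain x1 y1 where 1: "x1 \<in> X" "y1 \<in> Y" using assms by auto
  have h: "constrained H X Y xs y \<le> constrained H X Y xs ys"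
    "constrained H X Y xs ys \<le> constrained H X Y x ys" for x y
    using sp by (auto simp: saddle_point_def)
  \<comment> \<open>The order matters. For \<open>xs\<close> outside \<open>X\<close> the value is
    \<infinity> whatever \<open>ys\<close> is, because \<infinity> - \<infinity> = \<infinity>,
    whereas at \<open>x1\<close> it is not. Once \<open>xs\<close> is feasible, \<open>ys\<close>
    outside \<open>Y\<close> would give -\<infinity>, below the finite value at
    \<open>y1\<close>.\<close>
  from h(1)[of y1] h(2)[of x1] 1 show xs: "xs \<in> X"
    by (auto simp: constrained_def ind_def split: if_splits)
  with h(1)[of y1] 1 show ys: "ys \<in> Y"
    by (auto simp: constrained_def ind_def split: if_splits)
  show "H xs y \<le> H xs ys" if "y \<in> Y" for y
    using h(1)[of y] that xs ys by (auto simp: constrained_def ind_def)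
  show "H xs ys \<le> H x ys" if "x \<in> X" for x
    using h(2)[of x] that xs ys by (auto simp: constrained_def ind_def)
qed

section \<open>Differentiability of the regularised objective\<close>

lemma GDERIV_reg_x:
  "GDERIV (\<lambda>u. f u y) x :> v \<Longrightarrow> GDERIV (\<lambda>u. reg c r f u y z) x :> v + c *\<^sub>R (x - z)"
  unfolding reg_def pert_def
  using GDERIV_add[OF GDERIV_diff[OF _ GDERIV_const[of "r / 2 * (norm y)\<^sup>2"]] GDERIV_half_norm_sq]
  by fastforce

lemma GDERIV_reg_y:
  "GDERIV (f x) y :> v \<Longrightarrow> GDERIV (\<lambda>w. reg c r f x w z) y :> v - r *\<^sub>R y"
  unfolding reg_def pert_def
  using GDERIV_add[OF GDERIV_diff[OF _ GDERIV_half_norm_sq[where z=0]] GDERIV_const[of "c / 2 * (norm (x - z))\<^sup>2"]]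
  by fastforce

lemma cont_diff_reg:
  fixes f :: "'a::real_inner \<Rightarrow> 'b::real_inner \<Rightarrow> real"
  assumes "cont_diff f"
  shows "cont_diff (\<lambda>x y. reg c r f x y z)"
proof -
  from assms obtain G where G: "\<And>p. GDERIV (\<lambda>(x, y). f x y) p :> G p" "continuous_on UNIV G"
    unfolding cont_diff_def by blast
  define N where "N p = (c *\<^sub>R (fst p - z), - r *\<^sub>R snd p)" for p :: "'a \<times> 'b"
  have "GDERIV (\<lambda>p. c / 2 * (norm (fst p - z))\<^sup>2 - r / 2 * (norm (snd p))\<^sup>2) p :> N p" for p
    unfolding gderiv_def power2_norm_eq_inner N_def
    by (rule derivative_eq_intros refl | simp add: fun_eq_iff inner_prod_def inner_commute algebra_simps)+
  from GDERIV_add[OF G(1) this]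
  have "GDERIV (\<lambda>(x, y). reg c r f x y z) p :> G p + N p" for p
    by (simp add: reg_def pert_def case_prod_unfold algebra_simps)
  moreover have "continuous_on UNIV (\<lambda>p. G p + N p)"
    unfolding N_def by (intro continuous_intros G(2))
  ultimately show ?thesis
    unfolding cont_diff_def by (intro exI[of _ "\<lambda>p. G p + N p"]) simp
qed

text \<open>The index \<open>s\<close> is the first one at which \<open>P\<close> holds. The second
  conclusion serves twice: it bounds \<open>s\<close>, and it keeps \<open>p\<close> below
  \<open>p 0\<close> up to \<open>s\<close>.\<close>

lemma decrease_bounded_below_stops:
  fixes p :: "nat \<Rightarrow> real"
  assumes dec: "\<And>t. \<not> P t \<Longrightarrow> p (Suc t) \<le> p t - \<kappa>" and low: "\<And>t. m \<le> p t" and "0 < \<kappa>"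
  obtains s where "P s" "\<And>t. t \<le> s \<Longrightarrow> p t + real t * \<kappa> \<le> p 0"
proof -
  have down: "p t + real t * \<kappa> \<le> p 0" if "\<And>u. u < t \<Longrightarrow> \<not> P u" for t
    using that
  proof (induction t)
    case (Suc t)
    then have "p t + real t * \<kappa> \<le> p 0" "p (Suc t) \<le> p t - \<kappa>"
      using dec[of t] by auto
    then show ?case by (simp add: algebra_simps)
  qed simp
  have "\<exists>s. P s"
  proof (rule ccontr)
    assume none: "\<not> ?thesis"
    obtain n where "(p 0 - m) / \<kappa> < real n" using reals_Archimedean2 by blast
    moreover have "p n + real n * \<kappa> \<le> p 0" using down none by blast
    ultimately show False using low[of n] \<open>0 < \<kappa>\<close> by (simp add: field_simps)
  qed
  then obtain s where "P s" "\<And>u. u < s \<Longrightarrow> \<not> P u"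
    using LeastI_ex[of P] not_less_Least[of _ P] by metis
  with down that[of s] show ?thesis by (meson order.strict_trans2)
qed

lemma powr_three_halves: "0 < (u::real) \<Longrightarrow> u powr (3 / 2) = u * sqrt u"
  using powr_add[of u 1 "1/2"] by (simp add: powr_half_sqrt)

lemma powr_five_halves: "0 < (u::real) \<Longrightarrow> u powr (5 / 2) = u\<^sup>2 * sqrt u"
  using powr_add[of u 2 "1/2"] by (simp add: powr_half_sqrt)

subsection \<open>Proximal subproblems and stationarity\<close>

locale minimax =
  fixes f :: "'a::euclidean_space \<Rightarrow> 'b::euclidean_space \<Rightarrow> real" and X Y l
  assumes problem: "minimax_problem f X Y l"
begin

lemma X_props: "X \<noteq> {}" "closed X" "convex X"
  and Y_props: "Y \<noteq> {}" "compact Y" "convex Y" "0 \<in> Y" "closed Y" "bounded Y"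
  and diameter_pos: "diameter Y > 0"
  and f_cont_diff: "cont_diff f" and l_pos: "l > 0"
  and smooth: "smooth_on l X Y f"
  and concave: "x \<in> X \<Longrightarrow> concave_on Y (\<lambda>y. f x y)"
  and bdd_below_max: "bdd_below ((\<lambda>x. SUP y\<in>Y. f x y) ` X)"
  using problem by (auto simp: minimax_problem_def compact_imp_closed compact_imp_bounded)

lemmas grad_x = cont_diff_partials(1)[OF f_cont_diff]
  and grad_y = cont_diff_partials(2)[OF f_cont_diff]

lemma grad_x_lipschitz:
  "x \<in> X \<Longrightarrow> x' \<in> X \<Longrightarrow> y \<in> Y \<Longrightarrow> y' \<in> Y \<Longrightarrow>
    norm (grad_x f x y - grad_x f x' y') \<le> l * (norm (x - x') + norm (y - y'))"
  and grad_y_lipschitz: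
  "x \<in> X \<Longrightarrow> x' \<in> X \<Longrightarrow> y \<in> Y \<Longrightarrow> y' \<in> Y \<Longrightarrow>
    norm (grad_y f x y - grad_y f x' y') \<le> l * (norm (x - x') + norm (y - y'))"
  using smooth by (auto simp: smooth_on_def)

lemma norm_diff_le_diameter: "y \<in> Y \<Longrightarrow> y' \<in> Y \<Longrightarrow> norm (y - y') \<le> diameter Y"
  using diameter_bounded_bound[OF Y_props(6)] by (simp add: dist_norm)

lemma norm_le_diameter: "y \<in> Y \<Longrightarrow> norm y \<le> diameter Y"
  using norm_diff_le_diameter[OF _ Y_props(4)] by fastforce

lemma continuous_on_f_y: "continuous_on S (f x)"
  using grad_y unfolding gderiv_def
  by (meson continuous_at_imp_continuous_on has_derivative_continuous)

lemma continuous_on_f_x: "continuous_on S (\<lambda>x. f x y)"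
  using grad_x unfolding gderiv_def
  by (meson continuous_at_imp_continuous_on has_derivative_continuous)

lemma f_weakly_convex:
  assumes "y \<in> Y"
  shows "convex_on X (\<lambda>x. f x y + l / 2 * (norm x)\<^sup>2)"
  using grad_x_lipschitz[of _ _ y y] assms
  by (intro convex_on_of_lipschitz_gradient[OF X_props(3) grad_x]) auto

section \<open>The perturbed max function and its proximal points\<close>

definition V :: "real \<Rightarrow> 'a \<Rightarrow> real" where
  "V r x = (SUP y\<in>Y. pert r f x y)"

lemma bdd_above_pert: "bdd_above (pert r f x ` Y)"
proof -
  have "continuous_on Y (pert r f x)"
    unfolding pert_def by (intro continuous_intros continuous_on_f_y)
  then show ?thesis
    by (metis Y_props(2) bounded_imp_bdd_above compact_continuous_image compact_imp_bounded)
qed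

lemma V_upper: "y \<in> Y \<Longrightarrow> pert r f x y \<le> V r x"
  unfolding V_def by (rule cSUP_upper[OF _ bdd_above_pert])

lemma V_least: "(\<And>y. y \<in> Y \<Longrightarrow> pert r f x y \<le> c) \<Longrightarrow> V r x \<le> c"
  unfolding V_def by (rule cSUP_least[OF Y_props(1)])

lemma V_zero: "V 0 x = (SUP y\<in>Y. f x y)"
  by (simp add: V_def pert_def)

lemma f_le_V: "y \<in> Y \<Longrightarrow> f x y \<le> V 0 x"
  using V_upper[of y 0 x] by (simp add: pert_def)

lemma V_antimono: "0 \<le> r \<Longrightarrow> V r x \<le> V 0 x"
  by (rule V_least, rule order_trans[OF _ V_upper]) (auto simp: pert_def)

text \<open>The perturbation lowers each value by \<open>r / 2 * (norm y)\<^sup>2\<close>, and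
  \<open>0 \<in> Y\<close> bounds \<open>norm y\<close> by the diameter.\<close>

lemma V_zero_le:
  assumes "0 \<le> r"
  shows "V 0 x \<le> V r x + r / 2 * (diameter Y)\<^sup>2"
proof (rule V_least)
  fix y assume "y \<in> Y"
  then have "(norm y)\<^sup>2 \<le> (diameter Y)\<^sup>2"
    using norm_le_diameter[of y] by (intro power_mono) auto
  with assms have "r / 2 * (norm y)\<^sup>2 \<le> r / 2 * (diameter Y)\<^sup>2"
    by (intro mult_left_mono) auto
  with V_upper[OF \<open>y \<in> Y\<close>, of r x] show "pert 0 f x y \<le> V r x + r / 2 * (diameter Y)\<^sup>2"
    by (simp add: pert_def)
qed

definition Vmin :: real where "Vmin = (INF x\<in>X. V 0 x)"

lemma Vmin_le: "x \<in> X \<Longrightarrow> Vmin \<le> V 0 x"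
  unfolding Vmin_def by (rule cINF_lower) (use bdd_below_max in \<open>simp_all add: V_zero\<close>)

lemma Vmin_le_pert:
  "x \<in> X \<Longrightarrow> 0 \<le> r \<Longrightarrow> Vmin - r / 2 * (diameter Y)\<^sup>2 \<le> V r x"
  using Vmin_le V_zero_le by (smt (verit))

lemma INF_V_le: "x \<in> X \<Longrightarrow> 0 \<le> r \<Longrightarrow> (INF x\<in>X. V r x) \<le> V r x"
  by (rule cINF_lower) (auto intro!: bdd_belowI2[OF Vmin_le_pert])

text \<open>Adding the quadratic makes every \<open>f x y\<close> convex in \<open>x\<close>, and a
  supremum of convex functions is convex.\<close>

lemma V_weakly_convex: "convex_on X (\<lambda>x. V 0 x + l / 2 * (norm x)\<^sup>2)"
proof (rule convex_onI[OF _ X_props(3)])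
  fix t :: real and a b assume t: "t > 0" "t < 1" and ab: "a \<in> X" "b \<in> X"
  let ?p = "(1 - t) *\<^sub>R a + t *\<^sub>R b" and ?q = "\<lambda>x::'a. l / 2 * (norm x)\<^sup>2"
  have "V 0 ?p \<le> (1 - t) * (V 0 a + ?q a) + t * (V 0 b + ?q b) - ?q ?p"
  proof (rule V_least)
    fix y assume y: "y \<in> Y"
    have "f ?p y + ?q ?p \<le> (1 - t) * (f a y + ?q a) + t * (f b y + ?q b)"
      using convex_onD[OF f_weakly_convex[OF y], of t a b] t ab by simp
    also have "\<dots> \<le> (1 - t) * (V 0 a + ?q a) + t * (V 0 b + ?q b)"
      using f_le_V[OF y] t l_pos by (intro add_mono mult_left_mono) auto
    finally show "pert 0 f ?p y \<le> (1 - t) * (V 0 a + ?q a) + t * (V 0 b + ?q b) - ?q ?p"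
      by (simp add: pert_def)
  qed
  then show "V 0 ?p + ?q ?p \<le> (1 - t) * (V 0 a + ?q a) + t * (V 0 b + ?q b)" by linarith
qed

text \<open>\<open>prox\<close> is a chosen minimiser, so something is known about it only once a
  minimiser exists. The sublevel set through \<open>x\<close> is compact: closed as an intersection
  over \<open>y\<close>, and bounded because \<open>V 0\<close> is at least \<open>Vmin\<close> on
  \<open>X\<close> while the proximal term grows.\<close>

lemma prox_primal:
  assumes x: "x \<in> X"
  defines "w \<equiv> prox (1 / (2 * l)) (primal f X Y) x"
  shows "w \<in> X" and "\<And>u. u \<in> X \<Longrightarrow> V 0 w + l * (norm (w - x))\<^sup>2 \<le> V 0 u + l * (norm (u - x))\<^sup>2"
proof -
  define g where "g u = V 0 u + l * (norm (u - x))\<^sup>2" for u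
  define \<phi> where "\<phi> u = primal f X Y u + ereal (1 / (2 * (1 / (2 * l))) * (norm (u - x))\<^sup>2)" for u
  have \<phi>: "\<phi> u = (if u \<in> X then ereal (g u) else \<infinity>)" for u
    using l_pos by (simp add: \<phi>_def g_def primal_def ind_def V_zero)
  define S where "S = {u \<in> X. g u \<le> g x}"
  have cl: "closed {u \<in> X. g u \<le> c}" for c
  proof -
    have "g u \<le> c \<longleftrightarrow> (\<forall>y\<in>Y. f u y + l * (norm (u - x))\<^sup>2 \<le> c)" for u
      unfolding g_def using V_least[of 0 u "c - l * (norm (u - x))\<^sup>2"] f_le_V[of _ u]
      by (force simp: pert_def)
    then have "{u \<in> X. g u \<le> c} = X \<inter> (\<Inter>y\<in>Y. {u. f u y + l * (norm (u - x))\<^sup>2 \<le> c})"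
      by auto
    also have "closed \<dots>"
      by (intro closed_Int X_props closed_INT ballI closed_Collect_le continuous_intros continuous_on_f_x)
    finally show ?thesis .
  qed
  have "bounded S"
  proof (rule bounded_subset[OF bounded_cball])
    show "S \<subseteq> cball x (sqrt ((g x - Vmin) / l))"
    proof
      fix u assume "u \<in> S"
      then have "l * (norm (u - x))\<^sup>2 \<le> g x - Vmin"
        using Vmin_le[of u] by (auto simp: S_def g_def)
      then have "norm (u - x) \<le> sqrt ((g x - Vmin) / l)"
        using l_pos by (intro real_le_rsqrt) (simp add: field_simps)
      then show "u \<in> cball x (sqrt ((g x - Vmin) / l))"
        by (simp add: dist_norm norm_minus_commute)
    qed
  qed
  moreover have "closed S" unfolding S_def by (rule cl)
  ultimately have "compact S" by (simp add: compact_eq_bounded_closed)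
  have "x \<in> S" using x by (simp add: S_def)
  have "closed {u \<in> S. g u \<le> c}" for c
  proof -
    have "{u \<in> S. g u \<le> c} = {u \<in> X. g u \<le> min c (g x)}" by (auto simp: S_def)
    then show ?thesis by (simp only: cl)
  qed
  then obtain m where m: "m \<in> S" "\<And>u. u \<in> S \<Longrightarrow> g m \<le> g u"
    using compact_attains_inf_closed_sublevels[OF \<open>compact S\<close>, of g] \<open>x \<in> S\<close> by auto
  have "g m \<le> g u" if "u \<in> X" for u
    using m(2)[of u] m(2)[OF \<open>x \<in> S\<close>] that by (cases "g u \<le> g x") (auto simp: S_def)
  with m have "is_arg_min \<phi> (\<lambda>_. True) m"
    by (auto simp: is_arg_min_def \<phi> S_def not_less)
  then have "is_arg_min \<phi> (\<lambda>_. True) w"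
    unfolding w_def prox_def arg_min_def \<phi>_def by (rule someI)
  then have le: "\<phi> w \<le> \<phi> u" for u by (auto simp: is_arg_min_def not_less)
  from le[of x] x show "w \<in> X" by (auto simp: \<phi> split: if_splits)
  then show "V 0 w + l * (norm (w - x))\<^sup>2 \<le> V 0 u + l * (norm (u - x))\<^sup>2" if "u \<in> X" for u
    using le[of u] that by (simp add: \<phi> g_def)
qed

section \<open>Saddle points of the regularised subproblem, in real-valued form\<close>

definition sol :: "real \<Rightarrow> real \<Rightarrow> 'a \<Rightarrow> 'a \<Rightarrow> 'b \<Rightarrow> bool" where
  "sol c r z xs ys \<longleftrightarrow> xs \<in> X \<and> ys \<in> Y \<and>
     (\<forall>y\<in>Y. reg c r f xs y z \<le> reg c r f xs ys z) \<and>
     (\<forall>x\<in>X. reg c r f xs ys z \<le> reg c r f x ys z)"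

lemma solD:
  assumes "sol c r z xs ys"
  shows "xs \<in> X" "ys \<in> Y" "\<And>y. y \<in> Y \<Longrightarrow> reg c r f xs y z \<le> reg c r f xs ys z"
    "\<And>x. x \<in> X \<Longrightarrow> reg c r f xs ys z \<le> reg c r f x ys z"
  using assms by (auto simp: sol_def)

lemma reg_strongly_convex:
  assumes "y \<in> Y"
  shows "convex_on X (\<lambda>x. reg c r f x y z - (c - l) / 2 * (norm x)\<^sup>2)"
proof -
  have "convex_on X (\<lambda>x. pert r f x y + l / 2 * (norm x)\<^sup>2)"
    using convex_on_add[OF f_weakly_convex[OF assms]
        iffD2[OF convex_on_const[of X "- (r / 2 * (norm y)\<^sup>2)"] X_props(3)]]
    by (simp add: pert_def algebra_simps)
  from convex_on_recentre_norm_sq[OF this] show ?thesis by (simp add: reg_def)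
qed

lemma reg_strongly_concave:
  assumes "x \<in> X"
  shows "concave_on Y (\<lambda>y. reg c r f x y z + r / 2 * (norm y)\<^sup>2)"
  using convex_on_add[OF concave[OF assms, unfolded concave_on_def]
      iffD2[OF convex_on_const[of Y "- (c / 2 * (norm (x - z))\<^sup>2)"] Y_props(3)]]
  by (simp add: concave_on_def reg_def pert_def algebra_simps)

text \<open>The quadratic terms add slope \<open>c\<close> to the gradient in \<open>x\<close> and
  slope \<open>r\<close> to the one in \<open>y\<close>; as \<open>r \<le> c\<close>, one constant
  serves both.\<close>

lemma smooth_on_reg:
  assumes "0 \<le> r" "r \<le> c"
  shows "smooth_on (c + l) X Y (\<lambda>x y. reg c r f x y z)"
proof -
  have gx: "grad_x (\<lambda>x y. reg c r f x y z) x y = grad_x f x y + c *\<^sub>R (x - z)" for x y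
    using nabla_eq[OF GDERIV_reg_x[where f=f, OF grad_x]] by (simp add: grad_x_def)
  have gy: "grad_y (\<lambda>x y. reg c r f x y z) x y = grad_y f x y - r *\<^sub>R y" for x y
    using nabla_eq[OF GDERIV_reg_y[where f=f, OF grad_y]] by (simp add: grad_y_def)
  show ?thesis
    unfolding smooth_on_def gx gy
  proof (intro ballI conjI)
    fix x x' y y' assume *: "x \<in> X" "x' \<in> X" "y \<in> Y" "y' \<in> Y"
    have "grad_x f x y + c *\<^sub>R (x - z) - (grad_x f x' y' + c *\<^sub>R (x' - z))
        = (grad_x f x y - grad_x f x' y') + c *\<^sub>R (x - x')" by (simp add: algebra_simps)
    also have "norm \<dots> \<le> l * (norm (x - x') + norm (y - y')) + c * norm (x - x')"
      using norm_triangle_ineq[of "grad_x f x y - grad_x f x' y'" "c *\<^sub>R (x - x')"]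
        grad_x_lipschitz[OF *] assms by simp
    also have "\<dots> \<le> (c + l) * (norm (x - x') + norm (y - y'))"
      using assms by (simp add: algebra_simps)
    finally show "norm (grad_x f x y + c *\<^sub>R (x - z) - (grad_x f x' y' + c *\<^sub>R (x' - z)))
      \<le> (c + l) * (norm (x - x') + norm (y - y'))" .
    have "grad_y f x y - r *\<^sub>R y - (grad_y f x' y' - r *\<^sub>R y')
        = (grad_y f x y - grad_y f x' y') - r *\<^sub>R (y - y')" by (simp add: algebra_simps)
    also have "norm \<dots> \<le> norm (grad_y f x y - grad_y f x' y') + r * norm (y - y')"
      using norm_triangle_ineq4[of "grad_y f x y - grad_y f x' y'" "r *\<^sub>R (y - y')"] assms by simp
    also have "\<dots> \<le> l * (norm (x - x') + norm (y - y')) + c * (norm (x - x') + norm (y - y'))"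
      using assms by (intro add_mono grad_y_lipschitz * mult_mono) auto
    finally show "norm (grad_y f x y - r *\<^sub>R y - (grad_y f x' y' - r *\<^sub>R y'))
      \<le> (c + l) * (norm (x - x') + norm (y - y'))" by (simp add: algebra_simps)
  qed
qed

lemma SUP_reg: "(SUP y\<in>Y. reg c r f x y z) = V r x + c / 2 * (norm (x - z))\<^sup>2"
proof (rule cSup_eq_non_empty)
  fix u assume "\<And>v. v \<in> (\<lambda>y. reg c r f x y z) ` Y \<Longrightarrow> v \<le> u"
  then have "V r x \<le> u - c / 2 * (norm (x - z))\<^sup>2"
    by (intro V_least) (force simp: reg_def)
  then show "V r x + c / 2 * (norm (x - z))\<^sup>2 \<le> u" by simp
qed (use V_upper Y_props in \<open>auto simp: reg_def\<close>)

lemma sol_value: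
  assumes "sol c r z xs ys"
  shows "reg c r f xs ys z = V r xs + c / 2 * (norm (xs - z))\<^sup>2"
proof (rule antisym)
  show "reg c r f xs ys z \<le> V r xs + c / 2 * (norm (xs - z))\<^sup>2"
    using V_upper[OF solD(2)[OF assms]] by (simp add: reg_def)
  have "V r xs \<le> reg c r f xs ys z - c / 2 * (norm (xs - z))\<^sup>2"
    using solD(3)[OF assms] by (intro V_least) (force simp: reg_def)
  then show "V r xs + c / 2 * (norm (xs - z))\<^sup>2 \<le> reg c r f xs ys z" by simp
qed

text \<open>With \<open>ys\<close> frozen the objective is \<open>(c - l)\<close>-strongly convex in
  \<open>x\<close> with minimiser \<open>xs\<close>. It lies below the maximum over \<open>y\<close>
  and agrees with it at \<open>xs\<close>, so its growth passes to the max function.\<close>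

lemma sol_growth:
  assumes s: "sol c r z xs ys" and w: "w \<in> X"
  shows "V r xs + c / 2 * (norm (xs - z))\<^sup>2 + (c - l) / 2 * (norm (w - xs))\<^sup>2
    \<le> V r w + c / 2 * (norm (w - z))\<^sup>2"
proof -
  have "reg c r f xs ys z + (c - l) / 2 * (norm (w - xs))\<^sup>2 \<le> reg c r f w ys z"
    using strongly_convex_min[OF reg_strongly_convex[OF solD(2)[OF s]] solD(1)[OF s] w] solD(4)[OF s]
    by blast
  then show ?thesis
    using V_upper[OF solD(2)[OF s], of r w] unfolding sol_value[OF s] by (simp add: reg_def)
qed

section \<open>The envelope, the initial gap and the descent per iteration\<close>

lemma envelope_le:
  assumes "x \<in> X" "0 \<le> r" "0 \<le> c"
  shows "envelope c r f X Y z \<le> V r x + c / 2 * (norm (x - z))\<^sup>2"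
  unfolding envelope_def SUP_reg
proof (rule cINF_lower[OF _ assms(1)], rule bdd_belowI2)
  fix x assume "x \<in> X"
  then show "Vmin - r / 2 * (diameter Y)\<^sup>2 \<le> V r x + c / 2 * (norm (x - z))\<^sup>2"
    using Vmin_le_pert[of x r] assms by (simp add: add_increasing2)
qed

lemma envelope_sol:
  assumes s: "sol c r z xs ys" and "0 \<le> r" "l \<le> c"
  shows "envelope c r f X Y z = V r xs + c / 2 * (norm (xs - z))\<^sup>2"
proof (rule antisym)
  show "envelope c r f X Y z \<le> V r xs + c / 2 * (norm (xs - z))\<^sup>2"
    using envelope_le[OF solD(1)[OF s]] assms l_pos by simp
  show "V r xs + c / 2 * (norm (xs - z))\<^sup>2 \<le> envelope c r f X Y z"
    unfolding envelope_def SUP_reg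
  proof (rule cINF_greatest[OF X_props(1)])
    fix w assume "w \<in> X"
    have "0 \<le> (c - l) / 2 * (norm (w - xs))\<^sup>2" using assms by simp
    with sol_growth[OF s \<open>w \<in> X\<close>]
    show "V r xs + c / 2 * (norm (xs - z))\<^sup>2 \<le> V r w + c / 2 * (norm (w - z))\<^sup>2" by linarith
  qed
qed

lemma initial_gap_eq: "initial_gap c r f X Y z = envelope c r f X Y z - (INF x\<in>X. V r x)"
  by (simp add: initial_gap_def V_def)

lemma sol_dist_le_gap:
  assumes "sol c r z xs ys" "0 \<le> r" "l \<le> c"
  shows "c / 2 * (norm (xs - z))\<^sup>2 \<le> envelope c r f X Y z - (INF x\<in>X. V r x)"
  using INF_V_le[OF solD(1)[OF assms(1)] assms(2)] envelope_sol[OF assms] by simp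

text \<open>\<open>r\<close> and \<open>c\<close> enter the bound monotonically, so the gap can be
  bounded before they are chosen; this is needed to fix a threshold for \<epsilon> in
  advance.\<close>

lemma initial_gap_le:
  assumes "x \<in> X" "0 \<le> r" "0 \<le> c"
  shows "initial_gap c r f X Y z
    \<le> V 0 x + c / 2 * (norm (x - z))\<^sup>2 - Vmin + r / 2 * (diameter Y)\<^sup>2"
proof -
  have "Vmin - r / 2 * (diameter Y)\<^sup>2 \<le> (INF x\<in>X. V r x)"
    by (rule cINF_greatest[OF X_props(1)]) (rule Vmin_le_pert[OF _ assms(2)])
  with envelope_le[OF assms, of z] V_antimono[OF assms(2), of x]
  show ?thesis by (simp add: initial_gap_eq)
qed

lemma envelope_descent:
  assumes s: "sol c r z xs ys" and "0 \<le> r" "l \<le> c" "0 \<le> \<beta>" "\<beta> \<le> 1"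
    and e: "(norm (x - xs))\<^sup>2 \<le> \<delta>"
  shows "envelope c r f X Y (z + \<beta> *\<^sub>R (x - z))
    \<le> envelope c r f X Y z - c * \<beta> / 2 * ((norm (xs - z))\<^sup>2 - \<delta>)"
proof -
  have c: "0 \<le> c" using assms l_pos by simp
  let ?z = "z + \<beta> *\<^sub>R (x - z)"
  \<comment> \<open>The new centre is a convex combination of \<open>z\<close> and \<open>x\<close>.
    Convexity of the squared distance replaces a share \<open>\<beta>\<close> of the old squared
    distance by the inner error.\<close>
  have "(norm (?z - xs))\<^sup>2 = (norm ((1 - \<beta>) *\<^sub>R z + \<beta> *\<^sub>R x - xs))\<^sup>2"
    by (simp add: algebra_simps)
  also have "\<dots> \<le> (1 - \<beta>) * (norm (z - xs))\<^sup>2 + \<beta> * (norm (x - xs))\<^sup>2"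
    unfolding norm_sq_segment using assms by simp
  also have "\<dots> \<le> (1 - \<beta>) * (norm (z - xs))\<^sup>2 + \<beta> * \<delta>"
    using e \<open>0 \<le> \<beta>\<close> by (simp add: mult_left_mono)
  finally have "c / 2 * (norm (xs - ?z))\<^sup>2 \<le> c / 2 * ((1 - \<beta>) * (norm (xs - z))\<^sup>2 + \<beta> * \<delta>)"
    using c by (simp add: norm_minus_commute mult_left_mono)
  with envelope_le[OF solD(1)[OF s] assms(2) c, of ?z] envelope_sol[OF s assms(2,3)]
  show ?thesis by (simp add: field_simps)
qed

section \<open>Game stationarity after one projected step\<close>

lemma infdist_projected_gradient:
  fixes S :: "'c::euclidean_space set"
  assumes "convex S" "closed S" "S \<noteq> {}" and u: "u = closest_point S (x - (1 / l) *\<^sub>R g)"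
    and le: "norm (h - g) + l * norm (x - u) \<le> \<epsilon>"
  shows "infdist 0 ((\<lambda>v. h + v) ` subdiff (ind S) u) \<le> \<epsilon>"
proof (rule infdist_le2)
  \<comment> \<open>The witness is \<open>l\<close> times the projection residual. Added to
    \<open>h\<close> it leaves only the gradient mismatch \<open>h - g\<close> and the scaled
    displacement \<open>x - u\<close>.\<close>
  have "l *\<^sub>R (x - (1 / l) *\<^sub>R g - u) \<in> subdiff (ind S) u"
    unfolding u using l_pos
    by (intro subdiff_ind_scaleR subdiff_ind_closest_point closest_point_in_set assms) auto
  then have "l *\<^sub>R (x - u) - g \<in> subdiff (ind S) u"
    using l_pos by (simp add: algebra_simps)
  then show "h + (l *\<^sub>R (x - u) - g) \<in> (\<lambda>v. h + v) ` subdiff (ind S) u" by blast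
  have "h + (l *\<^sub>R (x - u) - g) = (h - g) + l *\<^sub>R (x - u)" by simp
  also have "norm \<dots> \<le> norm (h - g) + l * norm (x - u)"
    using norm_triangle_ineq[of "h - g" "l *\<^sub>R (x - u)"] l_pos by simp
  finally show "dist 0 (h + (l *\<^sub>R (x - u) - g)) \<le> \<epsilon>" using le by simp
qed

text \<open>The exact step with \<open>gs\<close> fixes \<open>xs\<close>, and projections are
  nonexpansive, so the perturbed step lands within \<open>3 * e + k / l\<close> of
  \<open>xs\<close>; a further \<open>e\<close> leads from \<open>xs\<close> to \<open>x\<close>.
  The term \<open>k\<close> allows for the part of \<open>gs\<close> that comes from the
  regularisation.\<close>

lemma dist_projected_gradient:
  fixes S :: "'c::euclidean_space set"
  assumes "convex S" "closed S" and xs: "xs \<in> S" "\<And>w. w \<in> S \<Longrightarrow> 0 \<le> inner gs (w - xs)"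
    and x: "norm (x - xs) \<le> e" and g: "norm (gs - g) \<le> 2 * l * e + k"
  shows "norm (x - closest_point S (x - (1 / l) *\<^sub>R g)) \<le> 4 * e + k / l"
proof -
  let ?P = "closest_point S"
  have xs_eq: "?P (xs - (1 / l) *\<^sub>R gs) = xs"
    using l_pos by (intro closest_point_variational assms) auto
  have "norm (xs - ?P (x - (1 / l) *\<^sub>R g)) \<le> norm (xs - (1 / l) *\<^sub>R gs - (x - (1 / l) *\<^sub>R g))"
    using closest_point_lipschitz[OF assms(1,2), of "xs - (1 / l) *\<^sub>R gs" "x - (1 / l) *\<^sub>R g"] xs(1)
    by (auto simp: xs_eq dist_norm)
  also have "\<dots> = norm ((xs - x) - (1 / l) *\<^sub>R (gs - g))" by (simp add: algebra_simps)
  also have "\<dots> \<le> norm (xs - x) + (1 / l) * norm (gs - g)"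
    using norm_triangle_ineq4[of "xs - x" "(1 / l) *\<^sub>R (gs - g)"] l_pos by simp
  also have "\<dots> \<le> e + (1 / l) * (2 * l * e + k)"
    using x g l_pos by (intro add_mono mult_left_mono) (auto simp: norm_minus_commute)
  also have "\<dots> = 3 * e + k / l" using l_pos by (simp add: field_simps)
  finally show ?thesis
    using norm_triangle_ineq[of "x - xs" "xs - ?P (x - (1 / l) *\<^sub>R g)"] x by simp
qed

lemma game_stationary_gda_step:
  assumes s: "sol c r z xs ys" and "0 \<le> r" "0 \<le> c" and xy: "x \<in> X" "y \<in> Y"
    and e: "norm (x - xs) \<le> e" "norm (y - ys) \<le> e"
    and le: "12 * l * e + 2 * (c * norm (xs - z)) + 2 * (r * diameter Y) \<le> \<epsilon>"
  shows "game_stationary f X Y \<epsilon> (gda_step f X Y (1 / l) (x, y))"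
proof -
  note xs = solD(1,2)[OF s]
  define u where "u = closest_point X (x - (1 / l) *\<^sub>R grad_x f x y)"
  define v where "v = closest_point Y (y - (1 / l) *\<^sub>R (- grad_y f x y))"
  have uv: "u \<in> X" "v \<in> Y"
    unfolding u_def v_def using X_props Y_props closest_point_in_set by blast+
  have ex: "0 \<le> inner (grad_x f xs ys + c *\<^sub>R (xs - z)) (w - xs)" if "w \<in> X" for w
    by (rule first_order_optimality[OF X_props(3) xs(1) that
        GDERIV_reg_x[where f=f and r=r, OF grad_x] solD(4)[OF s]])
  \<comment> \<open>Maximality in \<open>y\<close> is treated as minimality of the negated
    objective.\<close>
  have "GDERIV (\<lambda>w. - reg c r f xs w z) ys :> - grad_y f xs ys + r *\<^sub>R ys"
    using GDERIV_minus[OF GDERIV_reg_y[where f=f and r=r, OF grad_y]] by force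
  from first_order_optimality[OF Y_props(3) xs(2) _ this] solD(3)[OF s]
  have ey: "0 \<le> inner (- grad_y f xs ys + r *\<^sub>R ys) (w - ys)" if "w \<in> Y" for w
    using that by simp
  have sum_e: "l * (norm (xs - x) + norm (ys - y)) \<le> 2 * l * e"
    using e l_pos by (simp add: norm_minus_commute)
  have "norm (grad_x f xs ys + c *\<^sub>R (xs - z) - grad_x f x y)
      \<le> norm (grad_x f xs ys - grad_x f x y) + norm (c *\<^sub>R (xs - z))"
    using norm_triangle_ineq[of "grad_x f xs ys - grad_x f x y" "c *\<^sub>R (xs - z)"]
    by (simp add: algebra_simps)
  also have "\<dots> \<le> 2 * l * e + c * norm (xs - z)"
    using order_trans[OF grad_x_lipschitz[OF xs(1) xy(1) xs(2) xy(2)] sum_e] assms by simp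
  finally have du: "norm (x - u) \<le> 4 * e + c * norm (xs - z) / l"
    unfolding u_def by (intro dist_projected_gradient[OF X_props(3,2) xs(1) ex e(1)])
  have "norm (- grad_y f xs ys + r *\<^sub>R ys - (- grad_y f x y))
      \<le> norm (grad_y f xs ys - grad_y f x y) + norm (r *\<^sub>R ys)"
    using norm_triangle_ineq[of "grad_y f x y - grad_y f xs ys" "r *\<^sub>R ys"]
    by (simp add: algebra_simps norm_minus_commute)
  also have "\<dots> \<le> 2 * l * e + r * diameter Y"
    using order_trans[OF grad_y_lipschitz[OF xs(1) xy(1) xs(2) xy(2)] sum_e] assms
      norm_le_diameter[OF xs(2)] by (simp add: add_mono mult_left_mono)
  finally have dv: "norm (y - v) \<le> 4 * e + r * diameter Y / l"
    unfolding v_def by (intro dist_projected_gradient[OF Y_props(3,5) xs(2) ey e(2)])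
  have nn: "0 \<le> c * norm (xs - z)" "0 \<le> r * diameter Y"
    using assms diameter_pos by simp_all
  have du': "l * norm (x - u) \<le> 4 * l * e + c * norm (xs - z)"
    using mult_left_mono[OF du, of l] l_pos by (simp add: distrib_left mult.assoc mult.left_commute)
  have dv': "l * norm (y - v) \<le> 4 * l * e + r * diameter Y"
    using mult_left_mono[OF dv, of l] l_pos by (simp add: distrib_left mult.assoc mult.left_commute)
  \<comment> \<open>The Lipschitz bound contains both displacements and the last summand repeats one
    of them: three times \<open>4 * l * e\<close>, and each regularisation term at most
    twice.\<close>
  have "norm (grad_x f u v - grad_x f x y) + l * norm (x - u) \<le> \<epsilon>"
    using grad_x_lipschitz[OF uv(1) xy(1) uv(2) xy(2)] du' dv' le nn
    by (simp add: norm_minus_commute algebra_simps)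
  then have 1: "infdist 0 ((\<lambda>w. grad_x f u v + w) ` subdiff (ind X) u) \<le> \<epsilon>"
    by (intro infdist_projected_gradient[OF X_props(3,2,1) u_def])
  have "norm (- grad_y f u v - (- grad_y f x y)) + l * norm (y - v) \<le> \<epsilon>"
    using grad_y_lipschitz[OF uv(1) xy(1) uv(2) xy(2)] du' dv' le nn
    by (simp add: norm_minus_commute algebra_simps)
  then have 2: "infdist 0 ((\<lambda>w. - grad_y f u v + w) ` subdiff (ind Y) v) \<le> \<epsilon>"
    by (intro infdist_projected_gradient[OF Y_props(3,5,1) v_def])
  have "gda_step f X Y (1 / l) (x, y) = (u, v)"
    by (simp add: gda_step_def u_def v_def)
  with 1 2 uv show ?thesis by (simp add: game_stationary_def)
qed

text \<open>The perturbed and the unperturbed proximal problems have different centres \<open>z\<close> and \<open>x\<close>.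
  Adding their quadratic growth inequalities cancels everything of order
  \<open>(norm (w - xs))\<^sup>2\<close> and leaves only the inner product of \<open>w - xs\<close> and \<open>xs - z\<close>.\<close>

lemma opt_stationary_of_sol:
  assumes s: "sol c r z xs ys" and "0 \<le> r" "0 \<le> c" and x: "x \<in> X"
    and e: "norm (x - xs) \<le> e" "e \<le> \<epsilon> / (8 * l)" and "0 < \<epsilon>"
    and d: "c * norm (xs - z) \<le> \<epsilon> / 16" and r: "r * (diameter Y)\<^sup>2 \<le> \<epsilon>\<^sup>2 / (8 * l)"
  shows "opt_stationary f X Y l \<epsilon> x"
proof -
  define w where "w = prox (1 / (2 * l)) (primal f X Y) x"
  note w = prox_primal[OF x, folded w_def]
  note xs = solD(1)[OF s]
  define E where "E = norm (w - x)"
  define h where "h = \<epsilon> / (2 * l)"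
  \<comment> \<open>The proximal term has curvature \<open>2 * l\<close>. The weak convexity of
    \<open>V 0\<close> uses up \<open>l\<close> of it, which leaves growth with modulus
    \<open>l\<close> around \<open>w\<close>.\<close>
  have "convex_on X (\<lambda>u. V 0 u + 2 * l / 2 * (norm (u - x))\<^sup>2 - (2 * l - l) / 2 * (norm u)\<^sup>2)"
    by (rule convex_on_recentre_norm_sq[OF V_weakly_convex])
  then have "convex_on X (\<lambda>u. (V 0 u + l * (norm (u - x))\<^sup>2) - l / 2 * (norm u)\<^sup>2)"
    by simp
  from strongly_convex_min[OF this w(1) xs w(2)]
  have G: "V 0 w + l * E\<^sup>2 + l / 2 * (norm (xs - w))\<^sup>2 \<le> V 0 xs + l * (norm (xs - x))\<^sup>2"
    by (simp add: E_def)
  note Q = sol_growth[OF s w(1)]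
  have "c / 2 * (norm (w - z))\<^sup>2 = c / 2 * (norm (w - xs))\<^sup>2 + c * inner (w - xs) (xs - z)
      + c / 2 * (norm (xs - z))\<^sup>2"
    unfolding power2_norm_eq_inner by (simp add: algebra_simps inner_commute)
  with G Q V_zero_le[OF assms(2), of xs] V_antimono[OF assms(2), of w]
  have "l * E\<^sup>2 \<le> r / 2 * (diameter Y)\<^sup>2 + l * (norm (xs - x))\<^sup>2 + c * inner (w - xs) (xs - z)"
    by (simp add: norm_minus_commute field_simps)
  \<comment> \<open>Here \<open>h\<close> is the target for \<open>E\<close>. In terms of
    \<open>\<epsilon> = 2 * l * h\<close> the hypotheses bound the perturbation by
    \<open>l * h\<^sup>2 / 4\<close>, the inner error by \<open>h / 4\<close> and
    \<open>c * norm (xs - z)\<close> by \<open>l * h / 8\<close>.\<close>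
  also have "\<dots> \<le> l * h\<^sup>2 / 4 + l * (h / 4)\<^sup>2 + l * h / 8 * (E + h / 4)"
  proof (intro add_mono)
    show "r / 2 * (diameter Y)\<^sup>2 \<le> l * h\<^sup>2 / 4"
      using r l_pos by (simp add: h_def power2_eq_square field_simps)
    have eh: "norm (xs - x) \<le> h / 4"
      using e by (simp add: h_def norm_minus_commute)
    then show "l * (norm (xs - x))\<^sup>2 \<le> l * (h / 4)\<^sup>2"
      using l_pos by (intro mult_left_mono power_mono) auto
    have "norm (w - xs) \<le> E + h / 4"
      using norm_triangle_ineq[of "w - x" "x - xs"] eh by (simp add: E_def norm_minus_commute)
    then have "(c * norm (xs - z)) * norm (w - xs) \<le> (\<epsilon> / 16) * (E + h / 4)"
      using d assms by (intro mult_mono) auto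
    moreover have "c * inner (w - xs) (xs - z) \<le> c * (norm (w - xs) * norm (xs - z))"
      using assms by (intro mult_left_mono norm_cauchy_schwarz) auto
    moreover have "\<epsilon> / 16 = l * h / 8" using l_pos by (simp add: h_def)
    ultimately show "c * inner (w - xs) (xs - z) \<le> l * h / 8 * (E + h / 4)"
      by (simp add: algebra_simps)
  qed
  also have "\<dots> = l * (11 / 32 * h\<^sup>2 + 1 / 8 * (h * E))"
    by (simp add: power2_eq_square field_simps)
  finally have E: "E\<^sup>2 \<le> 11 / 32 * h\<^sup>2 + 1 / 8 * (h * E)"
    using l_pos by simp
  \<comment> \<open>The coefficients add up to 15/32 < 1, so \<open>E > h\<close> would contradict
    the quadratic inequality.\<close>
  have "E \<le> h"
  proof (rule ccontr)
    assume "\<not> E \<le> h"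
    moreover have "0 < h" using assms l_pos by (simp add: h_def)
    ultimately have "h * h \<le> E * E" "h * E \<le> E * E" "0 < E * E"
      by (auto intro!: mult_mono)
    with E show False unfolding power2_eq_square by linarith
  qed
  with x show ?thesis
    by (simp add: opt_stationary_def E_def h_def w_def)
qed

text \<open>The guarantee is applied with smoothness \<open>c + l\<close> and moduli
  \<open>c - l\<close> and \<open>r\<close>.\<close>

lemma subproblem_solve:
  assumes foam: "foam_guarantee C K foam steps" and c: "3 * l < c" and r: "0 < r" "r \<le> l"
    and "x \<in> X" "y \<in> Y" and \<delta>: "0 < \<delta>" "\<delta> < 1"
    and xy': "(x', y') = foam (subproblem c r f X Y z) x y (c - l) r \<delta>"
  shows "x' \<in> X \<and> y' \<in> Y \<and> (\<exists>xs ys. sol c r z xs ys \<and>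
    (norm (x' - xs))\<^sup>2 + (norm (y' - ys))\<^sup>2 \<le> \<delta> \<and>
    real (steps (subproblem c r f X Y z) x y (c - l) r \<delta>)
      \<le> C * sqrt ((c + l) / (c - l) * ((c + l) / r)) *
        ln (K * ((c + l) / (c - l)) * ((c + l) / r) * (1 + (norm (x - xs))\<^sup>2 + (norm (y - ys))\<^sup>2) / \<delta>))"
proof -
  let ?H = "\<lambda>x y. reg c r f x y z"
  have "let h = constrained ?H X Y;
             (x', y') = foam h x y (c - l) r \<delta>;
             \<kappa>\<^sub>x = (c + l) / (c - l); \<kappa>\<^sub>y = (c + l) / r
         in x' \<in> X \<and> y' \<in> Y \<and>
            (\<exists>xs ys. saddle_point h xs ys \<and>
               (norm (x' - xs))\<^sup>2 + (norm (y' - ys))\<^sup>2 \<le> \<delta> \<and>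
               real (steps h x y (c - l) r \<delta>)
                 \<le> C * sqrt (\<kappa>\<^sub>x * \<kappa>\<^sub>y) *
                   ln (K * \<kappa>\<^sub>x * \<kappa>\<^sub>y * (1 + (norm (x - xs))\<^sup>2 + (norm (y - ys))\<^sup>2) / \<delta>))"
    by (rule foam[unfolded foam_guarantee_def, rule_format])
      (use assms l_pos X_props Y_props cont_diff_reg[OF f_cont_diff] smooth_on_reg[of r c]
        reg_strongly_convex reg_strongly_concave in auto)
  then obtain xs ys where sp: "saddle_point (subproblem c r f X Y z) xs ys" and
    rest: "x' \<in> X" "y' \<in> Y" "(norm (x' - xs))\<^sup>2 + (norm (y' - ys))\<^sup>2 \<le> \<delta>"
    "real (steps (subproblem c r f X Y z) x y (c - l) r \<delta>)
      \<le> C * sqrt ((c + l) / (c - l) * ((c + l) / r)) *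
        ln (K * ((c + l) / (c - l)) * ((c + l) / r) * (1 + (norm (x - xs))\<^sup>2 + (norm (y - ys))\<^sup>2) / \<delta>)"
    unfolding Let_def subproblem_def[symmetric] xy'[symmetric] prod.case by blast
  have "sol c r z xs ys"
    using saddle_point_constrainedD[OF sp[unfolded subproblem_def] X_props(1) Y_props(1)] by (simp add: sol_def)
  with rest show ?thesis by blast
qed

end

subsection \<open>Descent and complexity\<close>

text \<open>One run with constant perturbation, with the parameter rules in the form in which the
  analysis uses them. The third condition on \<open>\<delta>\<close> makes the inner error at most
  half the square of the accuracy sought for the distance to the centre.\<close>

locale psfoam = minimax f X Y l
  for f :: "'a::euclidean_space \<Rightarrow> 'b::euclidean_space \<Rightarrow> real" and X Y l +
  fixes C\<^sub>F K R b q c r \<epsilon> :: real and foam steps and \<beta> \<delta> :: "nat \<Rightarrow> real" and x y z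
  assumes foam: "foam_guarantee C\<^sub>F K foam steps"
    and constants: "C\<^sub>F > 0" "K \<ge> 1" "b > 0" "q > 0"
    and c: "3 * l < c" "c \<le> R * l"
    and r: "0 < r" "r \<le> l"
    and \<beta>: "b \<le> \<beta> t" "b \<le> 1 - \<beta> t"
    and \<delta>: "0 < \<delta> t" "\<delta> t < 1" "2 * \<delta> t \<le> (\<epsilon> / (16 * R * l))\<^sup>2" "ln (1 / \<delta> t) \<le> q * ln (1 / \<epsilon>)"
    and \<epsilon>: "0 < \<epsilon>" "1 \<le> ln (1 / \<epsilon>)"
    and run: "psfoam_run foam f X Y l c (\<lambda>_. r) \<beta> \<delta> x y z"
    and start: "x 0 \<in> X" "y 0 \<in> Y"
begin

definition gap :: real where "gap = initial_gap c r f X Y (z 0)"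

lemma R_gt: "3 < R"
  using less_le_trans[OF c] l_pos by simp

lemma step:
  "(x (Suc t), y (Suc t)) = foam (subproblem c r f X Y (z t)) (x t) (y t) (c - l) r (\<delta> t)"
  "z (Suc t) = z t + \<beta> t *\<^sub>R (x (Suc t) - z t)"
  using run by (auto simp: psfoam_run_def)

lemma iterates_in: "x t \<in> X \<and> y t \<in> Y"
proof (induction t)
  case (Suc t)
  then show ?case
    using subproblem_solve[OF foam c(1) r _ _ \<delta>(1,2) step(1)] by blast
qed (use start in simp)

definition cost :: "nat \<Rightarrow> nat" where
  "cost t = steps (subproblem c r f X Y (z t)) (x t) (y t) (c - l) r (\<delta> t)"

lemma solutions_exist:
  "\<exists>xs ys. \<forall>t. sol c r (z t) (xs t) (ys t) \<and>
    (norm (x (Suc t) - xs t))\<^sup>2 + (norm (y (Suc t) - ys t))\<^sup>2 \<le> \<delta> t \<and>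
    real (cost t) \<le> C\<^sub>F * sqrt ((c + l) / (c - l) * ((c + l) / r)) *
        ln (K * ((c + l) / (c - l)) * ((c + l) / r) *
          (1 + (norm (x t - xs t))\<^sup>2 + (norm (y t - ys t))\<^sup>2) / \<delta> t)"
proof -
  have "\<exists>xs ys. sol c r (z t) xs ys \<and>
    (norm (x (Suc t) - xs))\<^sup>2 + (norm (y (Suc t) - ys))\<^sup>2 \<le> \<delta> t \<and>
    real (cost t) \<le> C\<^sub>F * sqrt ((c + l) / (c - l) * ((c + l) / r)) *
        ln (K * ((c + l) / (c - l)) * ((c + l) / r) *
          (1 + (norm (x t - xs))\<^sup>2 + (norm (y t - ys))\<^sup>2) / \<delta> t)" for t
    unfolding cost_def
    using subproblem_solve[OF foam c(1) r _ _ \<delta>(1,2) step(1)] iterates_in by blast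
  then show ?thesis by metis
qed

text \<open>\<open>3 * l < c\<close> keeps the condition number in \<open>x\<close> below 2, so the
  product is of order \<open>l / r\<close>.\<close>

lemma condition_numbers:
  "1 \<le> (c + l) / (c - l) * ((c + l) / r)"
  "(c + l) / (c - l) * ((c + l) / r) \<le> 2 * (R + 1) * (l / r)"
proof -
  have x: "1 \<le> (c + l) / (c - l)" "(c + l) / (c - l) \<le> 2"
    using c l_pos by (simp_all add: field_simps)
  have y: "1 \<le> (c + l) / r" "(c + l) / r \<le> (R + 1) * (l / r)"
    using c l_pos r by (simp_all add: field_simps)
  show "1 \<le> (c + l) / (c - l) * ((c + l) / r)"
    using mult_mono[OF x(1) y(1)] x by simp
  show "(c + l) / (c - l) * ((c + l) / r) \<le> 2 * (R + 1) * (l / r)"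
    unfolding mult.assoc by (intro mult_mono x y) (use y in auto)
qed

text \<open>The first hypothesis makes \<open>l * gap / \<epsilon>\<^sup>2\<close> at least 1, so
  that a single iteration is absorbed by the bound. The second bounds all problem-dependent factors
  inside the inner logarithm by a power of \<open>1 / \<epsilon>\<close>.\<close>

lemma complexity:
  assumes gap: "\<epsilon>\<^sup>2 \<le> l * gap"
    and small: "2 * K * (R + 1) * (1 + (1 + 2 * sqrt (2 * gap / (3 * l)) + norm (x 0 - z 0))\<^sup>2
      + (diameter Y)\<^sup>2) * (l / r) \<le> 1 / \<epsilon> ^ 3"
  shows "\<exists>s xs ys. sol c r (z s) xs ys \<and> norm (x (Suc s) - xs) \<le> \<epsilon> / (16 * R * l) \<and>
    norm (y (Suc s) - ys) \<le> \<epsilon> / (16 * R * l) \<and> norm (xs - z s) \<le> \<epsilon> / (16 * R * l) \<and>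
    real (psfoam_steps steps f X Y l c (\<lambda>_. r) \<delta> x y z (Suc s) + 1)
      \<le> (400 * R\<^sup>2 / b + 1) * (C\<^sub>F * (q + 3) + 2) * sqrt (2 * (R + 1))
        * (l * gap / \<epsilon>\<^sup>2 * sqrt (l / r) * ln (1 / \<epsilon>))"
proof -
  obtain xs ys where sol: "\<And>t. sol c r (z t) (xs t) (ys t)"
    and acc: "\<And>t. (norm (x (Suc t) - xs t))\<^sup>2 + (norm (y (Suc t) - ys t))\<^sup>2 \<le> \<delta> t"
    and cost: "\<And>t. real (cost t) \<le> C\<^sub>F * sqrt ((c + l) / (c - l) * ((c + l) / r)) *
        ln (K * ((c + l) / (c - l)) * ((c + l) / r) *
          (1 + (norm (x t - xs t))\<^sup>2 + (norm (y t - ys t))\<^sup>2) / \<delta> t)"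
    using solutions_exist by blast
  define p where "p t = envelope c r f X Y (z t)" for t
  define d where "d t = norm (xs t - z t)" for t
  define h where "h = \<epsilon> / (16 * R * l)"
  \<comment> \<open>The guaranteed drop while \<open>d t\<close> exceeds \<open>h\<close>: there
    \<open>(d t)\<^sup>2 - \<delta> t\<close> is at least \<open>h\<^sup>2 / 2\<close>, and
    \<open>\<beta> t\<close> at least \<open>b\<close>.\<close>
  define \<kappa> where "\<kappa> = c * b * h\<^sup>2 / 4"
  define m where "m = (INF x\<in>X. V r x)"
  have cl: "l \<le> c" "0 < c" using c l_pos by linarith+
  have h: "0 < h" using \<epsilon> R_gt l_pos by (simp add: h_def)
  have \<kappa>: "0 < \<kappa>" using cl h constants by (simp add: \<kappa>_def)
  have gap_eq: "gap = p 0 - m"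
    by (simp add: gap_def initial_gap_eq p_def m_def)
  have d_le: "c / 2 * (d t)\<^sup>2 \<le> p t - m" for t
    using sol_dist_le_gap[OF sol _ cl(1)] r by (simp add: d_def p_def m_def)
  then have m_le: "m \<le> p t" for t
    using cl by (smt (verit) divide_pos_pos mult_nonneg_nonneg zero_le_power2)
  have acc_x: "(norm (x (Suc t) - xs t))\<^sup>2 \<le> \<delta> t" and acc_y: "(norm (y (Suc t) - ys t))\<^sup>2 \<le> \<delta> t" for t
    using acc[of t] zero_le_power2[of "norm (x (Suc t) - xs t)"] zero_le_power2[of "norm (y (Suc t) - ys t)"]
    by linarith+
  have \<delta>h: "2 * \<delta> t \<le> h\<^sup>2" for t using \<delta>(3)[of t] by (simp add: h_def)
  have dec: "p (Suc t) \<le> p t - \<kappa>" if "\<not> d t \<le> h" for t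
  proof -
    have "h\<^sup>2 \<le> (d t)\<^sup>2" using that h by (intro power_mono) auto
    with \<delta>h[of t] have "h\<^sup>2 / 2 \<le> (d t)\<^sup>2 - \<delta> t" by linarith
    then have "b * (h\<^sup>2 / 2) \<le> \<beta> t * ((d t)\<^sup>2 - \<delta> t)"
      using \<beta>(1)[of t] constants by (intro mult_mono) auto
    then have "c / 2 * (b * (h\<^sup>2 / 2)) \<le> c / 2 * (\<beta> t * ((d t)\<^sup>2 - \<delta> t))"
      using cl by (intro mult_left_mono) auto
    moreover have "p (Suc t) \<le> p t - c * \<beta> t / 2 * ((d t)\<^sup>2 - \<delta> t)"
      unfolding p_def d_def step(2)
      using envelope_descent[OF sol _ cl(1) _ _ acc_x] r \<beta>[of t] constants by auto
    moreover have "c * \<beta> t / 2 * ((d t)\<^sup>2 - \<delta> t) = c / 2 * (\<beta> t * ((d t)\<^sup>2 - \<delta> t))"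
      "\<kappa> = c / 2 * (b * (h\<^sup>2 / 2))"
      by (simp_all add: \<kappa>_def)
    ultimately show ?thesis by linarith
  qed
  obtain s where s: "d s \<le> h" and ps: "\<And>t. t \<le> s \<Longrightarrow> p t + real t * \<kappa> \<le> p 0"
    using decrease_bounded_below_stops[of "\<lambda>t. d t \<le> h" p \<kappa> m] dec m_le \<kappa> by blast

  \<comment> \<open>The iteration count is the total possible decrease over the drop per iteration;
    1024/3 is rounded up to 400.\<close>
  have "real s * \<kappa> \<le> gap" using ps[of s] m_le[of s] gap_eq by simp
  moreover have "3 * l * b * h\<^sup>2 / 4 \<le> \<kappa>"
    unfolding \<kappa>_def using c constants by (intro divide_right_mono mult_right_mono) auto
  ultimately have "real s * (3 * l * b * h\<^sup>2 / 4) \<le> gap"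
    by (meson mult_left_mono of_nat_0_le_iff order_trans)
  then have "real s * (3 * b * \<epsilon>\<^sup>2) \<le> 1024 * R\<^sup>2 * (l * gap)"
    using l_pos R_gt by (simp add: h_def power2_eq_square field_simps)
  then have "real s \<le> (1024 * R\<^sup>2 / (3 * b)) * (l * gap / \<epsilon>\<^sup>2)"
    using constants \<epsilon> by (simp add: field_simps)
  also have "\<dots> \<le> (400 * R\<^sup>2 / b) * (l * gap / \<epsilon>\<^sup>2)"
  proof (rule mult_right_mono)
    show "1024 * R\<^sup>2 / (3 * b) \<le> 400 * R\<^sup>2 / b" using constants by (simp add: field_simps)
    show "0 \<le> l * gap / \<epsilon>\<^sup>2" using gap zero_le_power2[of \<epsilon>] by (intro divide_nonneg_nonneg) linarith+
  qed
  finally have s_le: "real s \<le> (400 * R\<^sup>2 / b) * (l * gap / \<epsilon>\<^sup>2)" .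
  have W1: "1 \<le> l * gap / \<epsilon>\<^sup>2" using gap \<epsilon> by simp
  with s_le have s1: "real (Suc s) \<le> (400 * R\<^sup>2 / b + 1) * (l * gap / \<epsilon>\<^sup>2)"
    unfolding of_nat_Suc distrib_right by linarith

  have gap0: "0 \<le> gap" using m_le[of 0] gap_eq by simp
  have d_bound: "d t \<le> sqrt (2 * gap / (3 * l))" if "t \<le> s" for t
  proof -
    have "0 \<le> real t * \<kappa>" using \<kappa> by simp
    then have "c / 2 * (d t)\<^sup>2 \<le> gap" using d_le[of t] ps[OF that] gap_eq by linarith
    then have "(d t)\<^sup>2 \<le> 2 * gap / c" using cl by (simp add: field_simps)
    also have "\<dots> \<le> 2 * gap / (3 * l)"
      using c l_pos gap0 by (intro divide_left_mono) auto
    finally show ?thesis by (rule real_le_rsqrt)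
  qed
  \<comment> \<open>The 1 covers the inner error, and the two square roots bound \<open>d\<close> at
    two consecutive times. The last summand is for the starting point, which no inner run has
    produced.\<close>
  define M where "M = 1 + 2 * sqrt (2 * gap / (3 * l)) + norm (x 0 - z 0)"
  have dist_x: "norm (x t - xs t) \<le> M" if "t \<le> s" for t
  proof (cases t)
    case 0
    have "norm (x 0 - xs 0) \<le> norm (x 0 - z 0) + d 0"
      using norm_triangle_ineq4[of "x 0 - z 0" "xs 0 - z 0"] by (simp add: d_def)
    moreover have "0 \<le> sqrt (2 * gap / (3 * l))" using gap0 l_pos by simp
    ultimately show ?thesis using d_bound[OF le0] unfolding M_def 0 by linarith
  next
    case (Suc u)
    have "(norm (x t - xs u))\<^sup>2 \<le> 1\<^sup>2" using acc_x[of u] \<delta>(2)[of u] Suc by simp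
    then have a: "norm (x t - xs u) \<le> 1" by (rule power2_le_imp_le) simp
    \<comment> \<open>Averaging only brings the centre closer to the iterate, so the distance to the
      old centre suffices.\<close>
    have "x t - z t = (1 - \<beta> u) *\<^sub>R (x t - z u)"
      by (simp add: Suc step(2) algebra_simps)
    then have "norm (x t - z t) = (1 - \<beta> u) * norm (x t - z u)"
      using \<beta>(2)[of u] constants by simp
    also have "\<dots> \<le> norm (x t - z u)"
      using \<beta>(1)[of u] constants by (intro mult_left_le_one_le) (use \<beta>(2)[of u] in auto)
    also have "\<dots> \<le> norm (x t - xs u) + d u"
      using norm_triangle_ineq[of "x t - xs u" "xs u - z u"] by (simp add: d_def)
    finally have "norm (x t - z t) \<le> 1 + d u" using a by simp
    moreover have "norm (x t - xs t) \<le> norm (x t - z t) + d t"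
      using norm_triangle_ineq4[of "x t - z t" "xs t - z t"] by (simp add: d_def)
    ultimately show ?thesis using d_bound[of u] d_bound[of t] that Suc
      by (simp add: M_def) (smt (verit) norm_ge_zero)
  qed

  define L where "L = ln (1 / \<epsilon>)"
  have L1: "1 \<le> L" using \<epsilon> by (simp add: L_def)
  define k where "k = (c + l) / (c - l) * ((c + l) / r)"
  have k: "1 \<le> k" "k \<le> 2 * (R + 1) * (l / r)"
    using condition_numbers by (simp_all only: k_def)
  define S where "S = sqrt (2 * (R + 1)) * sqrt (l / r)"
  have S: "sqrt k \<le> S" "1 \<le> S"
  proof -
    show "sqrt k \<le> S"
      unfolding S_def real_sqrt_mult[symmetric] using k(2) by simp
    have "1 \<le> sqrt k" using k(1) by simp
    with \<open>sqrt k \<le> S\<close> show "1 \<le> S" by linarith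
  qed
  have cost_le: "real (cost t) \<le> C\<^sub>F * (q + 3) * (S * L)" if "t \<le> s" for t
  proof -
    define A where "A = 1 + (norm (x t - xs t))\<^sup>2 + (norm (y t - ys t))\<^sup>2"
    define A' where "A' = 1 + M\<^sup>2 + (diameter Y)\<^sup>2"
    have "A \<le> A'"
      unfolding A_def A'_def using dist_x[OF that] iterates_in[of t] solD(2)[OF sol, of t]
      by (intro add_mono power_mono norm_diff_le_diameter) auto
    have A: "1 \<le> A" by (simp add: A_def)
    \<comment> \<open>The constants inside the logarithm contribute 3 multiples of \<open>L\<close>,
      and the factor \<open>1 / \<delta> t\<close> contributes \<open>q\<close>.\<close>
    have "K * k * A \<le> K * (2 * (R + 1) * (l / r)) * A'"
      using constants R_gt l_pos r A
      by (intro mult_mono[OF mult_left_mono[OF k(2)] \<open>A \<le> A'\<close>]) auto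
    also have "\<dots> \<le> 1 / \<epsilon> ^ 3"
      using small unfolding M_def[symmetric] A'_def[symmetric] by (simp add: mult_ac)
    finally have "K * k * A / \<delta> t \<le> 1 / \<epsilon> ^ 3 / \<delta> t"
      by (rule divide_right_mono) (use \<delta>(1)[of t] in simp)
    moreover have "0 < K * k * A / \<delta> t"
      using constants k(1) A \<delta>(1)[of t] by (intro divide_pos_pos mult_pos_pos) auto
    ultimately have "ln (K * k * A / \<delta> t) \<le> ln (1 / \<epsilon> ^ 3 / \<delta> t)"
      by (meson ln_mono)
    also have "\<dots> = 3 * ln (1 / \<epsilon>) + ln (1 / \<delta> t)"
      using \<epsilon> \<delta>(1)[of t] by (simp add: ln_mult ln_div ln_realpow)
    also have "\<dots> \<le> (q + 3) * L"
      using \<delta>(4)[of t] by (simp add: L_def algebra_simps)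
    finally have "ln (K * k * A / \<delta> t) \<le> (q + 3) * L" .
    then have "C\<^sub>F * sqrt k * ln (K * k * A / \<delta> t) \<le> C\<^sub>F * sqrt k * ((q + 3) * L)"
      using constants k(1) by (intro mult_left_mono) auto
    also have "\<dots> \<le> C\<^sub>F * S * ((q + 3) * L)"
      using S constants L1 by (intro mult_right_mono mult_left_mono) auto
    finally show ?thesis
      using cost[of t] unfolding A_def k_def mult.assoc by (simp only: mult.left_commute)
  qed
  define Q where "Q = C\<^sub>F * (q + 3)"
  have SL: "1 \<le> S * L" using mult_mono[OF S(2) L1] S by simp
  have "real (psfoam_steps steps f X Y l c (\<lambda>_. r) \<delta> x y z (Suc s)) = (\<Sum>t<Suc s. real (cost t) + 1)"
    by (simp add: psfoam_steps_def cost_def add.commute)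
  also have "\<dots> \<le> (\<Sum>t<Suc s. (Q + 1) * (S * L))"
  proof (rule sum_mono)
    fix t assume "t \<in> {..<Suc s}"
    then have "real (cost t) \<le> Q * (S * L)" using cost_le unfolding Q_def by simp
    then show "real (cost t) + 1 \<le> (Q + 1) * (S * L)"
      using SL unfolding distrib_right by linarith
  qed
  also have "\<dots> = real (Suc s) * ((Q + 1) * (S * L))" by simp
  finally have "real (psfoam_steps steps f X Y l c (\<lambda>_. r) \<delta> x y z (Suc s) + 1)
      \<le> real (Suc s) * ((Q + 1) * (S * L)) + 1" by simp
  \<comment> \<open>As \<open>S * L\<close> is at least 1, the extra step for reading off a solution
    raises \<open>Q + 1\<close> to \<open>Q + 2\<close>; the first 1 paid for the outer
    steps.\<close>
  also have "\<dots> \<le> real (Suc s) * ((Q + 1) * (S * L)) + real (Suc s) * (S * L)"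
    using mult_mono[of 1 "real (Suc s)" 1 "S * L"] SL by simp
  also have "\<dots> = real (Suc s) * ((Q + 2) * (S * L))" by (simp add: algebra_simps)
  also have "\<dots> \<le> (400 * R\<^sup>2 / b + 1) * (l * gap / \<epsilon>\<^sup>2) * ((Q + 2) * (S * L))"
    using s1 SL constants by (intro mult_right_mono) (auto simp: Q_def)
  also have "\<dots> = (400 * R\<^sup>2 / b + 1) * (C\<^sub>F * (q + 3) + 2) * sqrt (2 * (R + 1))
        * (l * gap / \<epsilon>\<^sup>2 * sqrt (l / r) * ln (1 / \<epsilon>))"
    by (simp only: Q_def S_def L_def mult_ac)
  finally have "real (psfoam_steps steps f X Y l c (\<lambda>_. r) \<delta> x y z (Suc s) + 1)
      \<le> (400 * R\<^sup>2 / b + 1) * (C\<^sub>F * (q + 3) + 2) * sqrt (2 * (R + 1))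
        * (l * gap / \<epsilon>\<^sup>2 * sqrt (l / r) * ln (1 / \<epsilon>))" .
  moreover have "norm (x (Suc s) - xs s) \<le> h" "norm (y (Suc s) - ys s) \<le> h"
    using order_trans[OF acc_x, of s "h\<^sup>2"] order_trans[OF acc_y, of s "h\<^sup>2"] \<delta>h[of s] \<delta>(1)[of s] h
    by (simp_all add: power2_le_iff_abs_le)
  ultimately show ?thesis
    using sol[of s] s unfolding d_def h_def by blast
qed

end

context minimax
begin

text \<open>The range allowed for \<open>r\<close> contains both regimes of the theorem, of order
  \<open>\<epsilon> / D\<close> and \<open>\<epsilon>\<^sup>2 / (l * D\<^sup>2)\<close>, so both
  parts follow from this one bound.\<close>

lemma small_eps_complexity:
  assumes pos: "c\<^sub>1 > 0" "R > 3" "b > 0" "a > 0" "q > 0" "C\<^sub>F > 0" "K \<ge> 1" and start: "x\<^sub>0 \<in> X" "y\<^sub>0 \<in> Y"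
  defines "D \<equiv> diameter Y"
  defines "B \<equiv> (400 * R\<^sup>2 / b + 1) * (C\<^sub>F * (q + 3) + 2) * sqrt (2 * (R + 1))"
  shows "\<exists>\<epsilon>\<^sub>0. 0 < \<epsilon>\<^sub>0 \<and> \<epsilon>\<^sub>0 < 1 \<and> \<epsilon>\<^sub>0 \<le> l * D \<and>
    (\<forall>\<epsilon> foam steps c r \<beta> \<delta> x y z.
      0 < \<epsilon> \<and> \<epsilon> < \<epsilon>\<^sub>0 \<and> foam_guarantee C\<^sub>F K foam steps \<and>
      admissible_params R b a q l D \<epsilon> c (\<lambda>_. r) \<beta> \<delta> \<and>
      x 0 = x\<^sub>0 \<and> y 0 = y\<^sub>0 \<and> z 0 = z\<^sub>0 \<and>
      psfoam_run foam f X Y l c (\<lambda>_. r) \<beta> \<delta> x y z \<and>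
      \<epsilon>\<^sup>2 \<le> l * initial_gap c r f X Y z\<^sub>0 \<and>
      c\<^sub>1 * (\<epsilon>\<^sup>2 / (l * D\<^sup>2)) \<le> r \<and> r \<le> \<epsilon> / (8 * D) \<longrightarrow>
      (\<exists>s xs ys. sol c r (z s) xs ys \<and> x (Suc s) \<in> X \<and> y (Suc s) \<in> Y \<and>
        norm (x (Suc s) - xs) \<le> \<epsilon> / (16 * R * l) \<and> norm (y (Suc s) - ys) \<le> \<epsilon> / (16 * R * l) \<and>
        c * norm (xs - z s) \<le> \<epsilon> / 16 \<and>
        real (psfoam_steps steps f X Y l c (\<lambda>_. r) \<delta> x y z (Suc s) + 1)
          \<le> B * (l * initial_gap c r f X Y z\<^sub>0 / \<epsilon>\<^sup>2 * sqrt (l / r) * ln (1 / \<epsilon>))))"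
proof -
  \<comment> \<open>An upper bound for the initial gap that depends neither on \<epsilon> nor on the
    run.\<close>
  define g where "g = V 0 x\<^sub>0 + R * l / 2 * (norm (x\<^sub>0 - z\<^sub>0))\<^sup>2 - Vmin + l / 2 * D\<^sup>2"
  define A where "A u = 1 + (1 + 2 * sqrt (2 * u / (3 * l)) + norm (x\<^sub>0 - z\<^sub>0))\<^sup>2 + D\<^sup>2" for u
  define N where "N = 2 * K * (R + 1) * A g"
  have D: "D > 0" using diameter_pos by (simp add: D_def)
  have A: "1 \<le> A u" for u by (simp add: A_def)
  have N: "N > 0" using pos less_le_trans[OF zero_less_one A] by (simp add: N_def)
  \<comment> \<open>In order, the entries give \<open>1 \<le> ln (1 / \<epsilon>)\<close>,
    \<open>r \<le> l\<close>, \<open>\<delta> t < 1\<close>, the bound on the factors inside the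
    logarithm, and the bound on the inner error.\<close>
  define \<epsilon>\<^sub>0 where "\<epsilon>\<^sub>0 = Min {1 / 3, l * D, l, c\<^sub>1 / (N * (l\<^sup>2 * D\<^sup>2)), l * D / (R * sqrt (512 * a))}"
  have \<epsilon>\<^sub>0: "0 < \<epsilon>\<^sub>0" "\<epsilon>\<^sub>0 \<le> 1 / 3" "\<epsilon>\<^sub>0 \<le> l * D" "\<epsilon>\<^sub>0 \<le> l" "\<epsilon>\<^sub>0 \<le> c\<^sub>1 / (N * (l\<^sup>2 * D\<^sup>2))"
    "\<epsilon>\<^sub>0 \<le> l * D / (R * sqrt (512 * a))"
  proof -
    show "0 < \<epsilon>\<^sub>0" unfolding \<epsilon>\<^sub>0_def using l_pos D pos N by simp
  qed (unfold \<epsilon>\<^sub>0_def, (intro Min_le; simp)+)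
  show ?thesis
  proof (intro exI[of _ \<epsilon>\<^sub>0] conjI allI impI)
    fix \<epsilon> foam steps c r \<beta> \<delta> x y z
    assume H: "0 < \<epsilon> \<and> \<epsilon> < \<epsilon>\<^sub>0 \<and> foam_guarantee C\<^sub>F K foam steps \<and>
      admissible_params R b a q l D \<epsilon> c (\<lambda>_. r) \<beta> \<delta> \<and>
      x 0 = x\<^sub>0 \<and> y 0 = y\<^sub>0 \<and> z 0 = z\<^sub>0 \<and>
      psfoam_run foam f X Y l c (\<lambda>_. r) \<beta> \<delta> x y z \<and>
      \<epsilon>\<^sup>2 \<le> l * initial_gap c r f X Y z\<^sub>0 \<and>
      c\<^sub>1 * (\<epsilon>\<^sup>2 / (l * D\<^sup>2)) \<le> r \<and> r \<le> \<epsilon> / (8 * D)"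
    then have \<epsilon>: "0 < \<epsilon>" "\<epsilon> < \<epsilon>\<^sub>0" and r_low: "c\<^sub>1 * (\<epsilon>\<^sup>2 / (l * D\<^sup>2)) \<le> r" and r_up: "r \<le> \<epsilon> / (8 * D)"
      and c: "3 * l < c" "c \<le> R * l" and r: "0 < r"
      and \<beta>: "\<And>t. b \<le> \<beta> t" "\<And>t. b \<le> 1 - \<beta> t"
      and \<delta>: "\<And>t. 0 < \<delta> t" "\<And>t. \<delta> t \<le> a * (r ^ 4 * D\<^sup>2 / l ^ 4)" "\<And>t. ln (1 / \<delta> t) \<le> q * ln (1 / \<epsilon>)"
      and z0: "z 0 = z\<^sub>0" "x 0 = x\<^sub>0" "y 0 = y\<^sub>0"
      by (auto simp: admissible_params_def)
    have "\<epsilon> \<le> 8 * (l * D)" using \<epsilon> \<epsilon>\<^sub>0(3) mult_pos_pos[OF l_pos D] by linarith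
    then have "\<epsilon> / (8 * D) \<le> l" using D by (simp add: field_simps)
    with r_up have "r \<le> l" by simp
    have ln\<epsilon>: "1 \<le> ln (1 / \<epsilon>)"
    proof -
      have "3 \<le> 1 / \<epsilon>" using \<epsilon> \<epsilon>\<^sub>0(2) by (simp add: field_simps)
      then have "exp 1 \<le> 1 / \<epsilon>" using exp_le by linarith
      then show ?thesis using \<epsilon> by (simp add: ln_ge_iff)
    qed
    have \<delta>2: "2 * \<delta> t \<le> (\<epsilon> / (16 * R * l))\<^sup>2" for t
    proof -
      \<comment> \<open>512 is twice the square of the 16 in the target accuracy.\<close>
      have "\<epsilon> * (R * sqrt (512 * a)) \<le> l * D"
        using less_le_trans[OF \<epsilon>(2) \<epsilon>\<^sub>0(6)] pos by (simp add: pos_less_divide_eq)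
      then have "(\<epsilon> * (R * sqrt (512 * a)))\<^sup>2 \<le> (l * D)\<^sup>2"
        using \<epsilon> pos by (intro power_mono) auto
      then have a: "\<epsilon>\<^sup>2 * R\<^sup>2 * (512 * a) \<le> l\<^sup>2 * D\<^sup>2"
        using pos by (simp add: power_mult_distrib mult.assoc)
      have "r ^ 4 \<le> (\<epsilon> / D) ^ 4"
      proof (rule power_mono)
        have "\<epsilon> / (8 * D) \<le> \<epsilon> / D" using \<epsilon> D by (simp add: field_simps)
        then show "r \<le> \<epsilon> / D" using r_up by linarith
      qed (use r in simp)
      then have "a * (r ^ 4 * D\<^sup>2 / l ^ 4) \<le> a * ((\<epsilon> / D) ^ 4 * D\<^sup>2 / l ^ 4)"
        using pos l_pos by (intro mult_left_mono divide_right_mono mult_right_mono) auto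
      also have "\<dots> = \<epsilon>\<^sup>2 * (a * \<epsilon>\<^sup>2) / (D\<^sup>2 * l ^ 4)"
        using D by (simp add: power4_eq_xxxx power2_eq_square field_simps)
      also have "\<dots> \<le> \<epsilon>\<^sup>2 * (l\<^sup>2 * D\<^sup>2 / (512 * R\<^sup>2)) / (D\<^sup>2 * l ^ 4)"
        using a pos l_pos by (intro divide_right_mono mult_left_mono) (auto simp: field_simps)
      also have "\<dots> = (\<epsilon> / (16 * R * l))\<^sup>2 / 2"
        using D l_pos pos by (simp add: power4_eq_xxxx power2_eq_square field_simps)
      finally show ?thesis using \<delta>(2)[of t] by linarith
    qed
    have \<delta>1: "\<delta> t < 1" for t
    proof -
      have "3 * l < R * l" using pos l_pos by simp
      then have "\<epsilon> \<le> 16 * R * l" using \<epsilon> \<epsilon>\<^sub>0(4) l_pos by linarith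
      then have "\<epsilon> / (16 * R * l) \<le> 1" using l_pos pos by (simp add: divide_le_eq_1)
      then have "(\<epsilon> / (16 * R * l))\<^sup>2 \<le> 1"
        using \<epsilon> l_pos pos by (intro power_le_one) auto
      then show ?thesis using \<delta>2[of t] \<delta>(1)[of t] by linarith
    qed
    interpret run: psfoam f X Y l C\<^sub>F K R b q c r \<epsilon> foam steps \<beta> \<delta> x y z
      by unfold_locales (use H pos c r \<open>r \<le> l\<close> \<beta> \<delta> \<delta>1 \<delta>2 ln\<epsilon> start in auto)
    have gap: "\<epsilon>\<^sup>2 \<le> l * run.gap" using H by (simp add: run.gap_def)
    have "run.gap \<le> V 0 x\<^sub>0 + c / 2 * (norm (x\<^sub>0 - z\<^sub>0))\<^sup>2 - Vmin + r / 2 * D\<^sup>2"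
      unfolding run.gap_def D_def z0 using r c l_pos by (intro initial_gap_le start) auto
    also have "\<dots> \<le> g"
      unfolding g_def using c \<open>r \<le> l\<close>
      by (intro add_mono diff_mono mult_right_mono divide_right_mono) auto
    finally have "run.gap \<le> g" .
    have "0 \<le> l * run.gap" using gap zero_le_power2[of \<epsilon>] by linarith
    then have gap0: "0 \<le> run.gap" using l_pos by (simp add: zero_le_mult_iff)
    have "A run.gap \<le> A g"
      unfolding A_def using \<open>run.gap \<le> g\<close> gap0 l_pos D
      by (intro add_mono power_mono mult_left_mono divide_right_mono real_sqrt_le_mono) auto
    then have "2 * K * (R + 1) * A run.gap * (l / r) \<le> N * (l / r)"
      unfolding N_def using pos l_pos r by (intro mult_right_mono mult_left_mono) auto
    \<comment> \<open>The lower bound on \<open>r\<close> costs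
      \<open>1 / \<epsilon>\<^sup>2\<close>; one more factor \<open>1 / \<epsilon>\<close> absorbs
      the constants.\<close>
    also have "\<dots> \<le> N * (l\<^sup>2 * D\<^sup>2 / (c\<^sub>1 * \<epsilon>\<^sup>2))"
      using r_low r pos l_pos \<epsilon> D N
      by (intro mult_left_mono) (auto simp: field_simps power2_eq_square)
    also have "\<dots> \<le> 1 / \<epsilon> ^ 3"
    proof -
      have "\<epsilon> * (N * (l\<^sup>2 * D\<^sup>2)) \<le> c\<^sub>1"
        using less_le_trans[OF \<epsilon>(2) \<epsilon>\<^sub>0(5)] N l_pos D by (simp add: pos_less_divide_eq)
      then show ?thesis
        using \<epsilon> pos by (simp add: field_simps power3_eq_cube power2_eq_square)
    qed
    finally have "2 * K * (R + 1) * A run.gap * (l / r) \<le> 1 / \<epsilon> ^ 3" .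
    from run.complexity[OF gap, unfolded z0, folded D_def, folded A_def, OF this]
    obtain s xs ys where s: "sol c r (z s) xs ys" "norm (x (Suc s) - xs) \<le> \<epsilon> / (16 * R * l)"
      "norm (y (Suc s) - ys) \<le> \<epsilon> / (16 * R * l)" "norm (xs - z s) \<le> \<epsilon> / (16 * R * l)"
      "real (psfoam_steps steps f X Y l c (\<lambda>_. r) \<delta> x y z (Suc s) + 1)
      \<le> B * (l * initial_gap c r f X Y z\<^sub>0 / \<epsilon>\<^sup>2 * sqrt (l / r) * ln (1 / \<epsilon>))"
      unfolding B_def run.gap_def z0 by blast
    have "c * norm (xs - z s) \<le> (R * l) * (\<epsilon> / (16 * R * l))"
      using s(4) c l_pos pos by (intro mult_mono) auto
    also have "\<dots> = \<epsilon> / 16" using l_pos pos by simp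
    finally show "\<exists>s xs ys. sol c r (z s) xs ys \<and> x (Suc s) \<in> X \<and> y (Suc s) \<in> Y \<and>
        norm (x (Suc s) - xs) \<le> \<epsilon> / (16 * R * l) \<and> norm (y (Suc s) - ys) \<le> \<epsilon> / (16 * R * l) \<and>
        c * norm (xs - z s) \<le> \<epsilon> / 16 \<and>
        real (psfoam_steps steps f X Y l c (\<lambda>_. r) \<delta> x y z (Suc s) + 1)
          \<le> B * (l * initial_gap c r f X Y z\<^sub>0 / \<epsilon>\<^sup>2 * sqrt (l / r) * ln (1 / \<epsilon>))"
      using s run.iterates_in[of "Suc s"] by blast
  qed (use \<epsilon>\<^sub>0 in auto)
qed

end

text \<open>The upper factor for \<open>r\<close> is 1/8, which keeps the bias \<open>r * D\<close>
  or \<open>r * D\<^sup>2\<close> within the tolerance. The lower factor determines the price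
  \<open>sqrt (l / r)\<close> of an inner run.\<close>

theorem theorem6p1:
  shows
  "\<exists>c\<^sub>2 > 0. \<forall>c\<^sub>1 R b a q C\<^sub>F. c\<^sub>1 > 0 \<and> R > 3 \<and> b > 0 \<and> a > 0 \<and> q > 0 \<and> C\<^sub>F > 0 \<longrightarrow>
   (\<exists>C > 0.
    \<forall>(f :: real ^ 'n \<Rightarrow> real ^ 'd \<Rightarrow> real) X Y l x\<^sub>0 y\<^sub>0 z\<^sub>0 K.
      minimax_problem f X Y l \<and> x\<^sub>0 \<in> X \<and> y\<^sub>0 \<in> Y \<and> K \<ge> 1 \<longrightarrow>
     (\<exists>\<epsilon>\<^sub>0. 0 < \<epsilon>\<^sub>0 \<and> \<epsilon>\<^sub>0 < 1 \<and>
      (\<forall>\<epsilon> foam steps rx ry \<beta> \<delta> x y z.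
        0 < \<epsilon> \<and> \<epsilon> < \<epsilon>\<^sub>0 \<and>
        foam_guarantee C\<^sub>F K foam steps \<and>
        admissible_params R b a q l (diameter Y) \<epsilon> rx ry \<beta> \<delta> \<and>
        x 0 = x\<^sub>0 \<and> y 0 = y\<^sub>0 \<and> z 0 = z\<^sub>0 \<and>
        psfoam_run foam f X Y l rx ry \<beta> \<delta> x y z \<and>
        \<epsilon>\<^sup>2 \<le> l * initial_gap rx (ry 0) f X Y z\<^sub>0 \<longrightarrow>
        (\<forall>r. (\<forall>t. ry t = r) \<and>
             c\<^sub>1 * (\<epsilon> / diameter Y) \<le> r \<and> r \<le> c\<^sub>2 * (\<epsilon> / diameter Y) \<longrightarrow>
          (\<exists>t. game_stationary f X Y \<epsilon> (gda_step f X Y (1 / l) (x t, y t)) \<and>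
               real (psfoam_steps steps f X Y l rx ry \<delta> x y z t + 1)
                 \<le> C * (l powr 1.5 * diameter Y powr 0.5 * initial_gap rx (ry 0) f X Y z\<^sub>0
                          / \<epsilon> powr 2.5 * ln (1 / \<epsilon>)))) \<and>
        (\<forall>r. (\<forall>t. ry t = r) \<and>
             c\<^sub>1 * (\<epsilon>\<^sup>2 / (l * (diameter Y)\<^sup>2)) \<le> r \<and> r \<le> c\<^sub>2 * (\<epsilon>\<^sup>2 / (l * (diameter Y)\<^sup>2)) \<longrightarrow>
          (\<exists>t. opt_stationary f X Y l \<epsilon> (x t) \<and>
               real (psfoam_steps steps f X Y l rx ry \<delta> x y z t)
                 \<le> C * (l\<^sup>2 * diameter Y * initial_gap rx (ry 0) f X Y z\<^sub>0
                          / \<epsilon> ^ 3 * ln (1 / \<epsilon>)))))))"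
proof (rule exI[of _ "1 / 8"], intro conjI allI impI, goal_cases)
  case (2 c\<^sub>1 R b a q C\<^sub>F)
  then have pos: "c\<^sub>1 > 0" "R > 3" "b > 0" "a > 0" "q > 0" "C\<^sub>F > 0" by auto
  define B where "B = (400 * R\<^sup>2 / b + 1) * (C\<^sub>F * (q + 3) + 2) * sqrt (2 * (R + 1))"
  have B: "0 < B"
    unfolding B_def using pos by (intro mult_pos_pos add_nonneg_pos) auto
  show ?case
  \<comment> \<open>\<open>B\<close> is the constant of the iteration bound;
    \<open>sqrt c\<^sub>1\<close> enters through \<open>sqrt (l / r)\<close>.\<close>
  proof (rule exI[of _ "B / sqrt c\<^sub>1"], intro conjI allI impI, goal_cases)
    case (2 f X Y l x\<^sub>0 y\<^sub>0 z\<^sub>0 K)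
    then interpret minimax f X Y l by unfold_locales auto
    from 2 have start: "x\<^sub>0 \<in> X" "y\<^sub>0 \<in> Y" "K \<ge> 1" by auto
    define D where "D = diameter Y"
    have D: "D > 0" using diameter_pos by (simp add: D_def)
    from small_eps_complexity[OF pos start(3,1,2), of z\<^sub>0, folded D_def B_def]
    obtain \<epsilon>\<^sub>0 where \<epsilon>\<^sub>0: "0 < \<epsilon>\<^sub>0" "\<epsilon>\<^sub>0 < 1" "\<epsilon>\<^sub>0 \<le> l * D" and
      main: "\<And>\<epsilon> foam steps c r \<beta> \<delta> x y z.
      0 < \<epsilon> \<and> \<epsilon> < \<epsilon>\<^sub>0 \<and> foam_guarantee C\<^sub>F K foam steps \<and>
      admissible_params R b a q l D \<epsilon> c (\<lambda>_. r) \<beta> \<delta> \<and>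
      x 0 = x\<^sub>0 \<and> y 0 = y\<^sub>0 \<and> z 0 = z\<^sub>0 \<and>
      psfoam_run foam f X Y l c (\<lambda>_. r) \<beta> \<delta> x y z \<and>
      \<epsilon>\<^sup>2 \<le> l * initial_gap c r f X Y z\<^sub>0 \<and>
      c\<^sub>1 * (\<epsilon>\<^sup>2 / (l * D\<^sup>2)) \<le> r \<and> r \<le> \<epsilon> / (8 * D) \<Longrightarrow>
      \<exists>s xs ys. sol c r (z s) xs ys \<and> x (Suc s) \<in> X \<and> y (Suc s) \<in> Y \<and>
        norm (x (Suc s) - xs) \<le> \<epsilon> / (16 * R * l) \<and> norm (y (Suc s) - ys) \<le> \<epsilon> / (16 * R * l) \<and>
        c * norm (xs - z s) \<le> \<epsilon> / 16 \<and>
        real (psfoam_steps steps f X Y l c (\<lambda>_. r) \<delta> x y z (Suc s) + 1)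
          \<le> B * (l * initial_gap c r f X Y z\<^sub>0 / \<epsilon>\<^sup>2 * sqrt (l / r) * ln (1 / \<epsilon>))"
      by metis
    show ?case
      unfolding D_def[symmetric]
    proof (rule exI[of _ \<epsilon>\<^sub>0], intro conjI allI impI, goal_cases)
      case H: (3 \<epsilon> foam steps c ry \<beta> \<delta> x y z r)
      then have ry: "ry = (\<lambda>_. r)" by auto
      define g where "g = initial_gap c r f X Y z\<^sub>0"
      from H have \<epsilon>: "0 < \<epsilon>" "\<epsilon> < \<epsilon>\<^sub>0" and gap: "\<epsilon>\<^sup>2 \<le> l * g" and c: "3 * l < c"
        and r0: "0 < r" and r: "c\<^sub>1 * (\<epsilon> / D) \<le> r" "r \<le> \<epsilon> / (8 * D)"
        by (auto simp: ry g_def admissible_params_def)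
      \<comment> \<open>\<open>\<epsilon> \<le> l * D\<close> orders the two regimes, so the larger
        \<open>r\<close> of the first part also meets the lower bound.\<close>
      have "\<epsilon> / (l * D) * (\<epsilon> / D) \<le> 1 * (\<epsilon> / D)"
        using \<epsilon> \<epsilon>\<^sub>0 D l_pos by (intro mult_right_mono) auto
      then have "c\<^sub>1 * (\<epsilon>\<^sup>2 / (l * D\<^sup>2)) \<le> c\<^sub>1 * (\<epsilon> / D)"
        using pos by (intro mult_left_mono) (auto simp: power2_eq_square mult_ac)
      with r have r_low: "c\<^sub>1 * (\<epsilon>\<^sup>2 / (l * D\<^sup>2)) \<le> r" by linarith
      have "\<exists>s xs ys. sol c r (z s) xs ys \<and> x (Suc s) \<in> X \<and> y (Suc s) \<in> Y \<and>
        norm (x (Suc s) - xs) \<le> \<epsilon> / (16 * R * l) \<and> norm (y (Suc s) - ys) \<le> \<epsilon> / (16 * R * l) \<and>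
        c * norm (xs - z s) \<le> \<epsilon> / 16 \<and>
        real (psfoam_steps steps f X Y l c (\<lambda>_. r) \<delta> x y z (Suc s) + 1)
          \<le> B * (l * initial_gap c r f X Y z\<^sub>0 / \<epsilon>\<^sup>2 * sqrt (l / r) * ln (1 / \<epsilon>))"
        by (rule main[where foam=foam and \<beta>=\<beta>]) (use H r_low r in \<open>simp add: ry\<close>)
      then obtain s xs ys where s: "sol c r (z s) xs ys" "x (Suc s) \<in> X" "y (Suc s) \<in> Y"
        "norm (x (Suc s) - xs) \<le> \<epsilon> / (16 * R * l)" "norm (y (Suc s) - ys) \<le> \<epsilon> / (16 * R * l)"
        "c * norm (xs - z s) \<le> \<epsilon> / 16"
        and steps: "real (psfoam_steps steps f X Y l c (\<lambda>_. r) \<delta> x y z (Suc s) + 1)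
          \<le> B * (l * g / \<epsilon>\<^sup>2 * sqrt (l / r) * ln (1 / \<epsilon>))"
        unfolding g_def by blast
      have "game_stationary f X Y \<epsilon> (gda_step f X Y (1 / l) (x (Suc s), y (Suc s)))"
      proof (rule game_stationary_gda_step[OF s(1) _ _ s(2-5)])
        \<comment> \<open>The budget is 1/4 for the inner error, 1/8 for the distance to the centre
          and 1/4 for the perturbation, together 5/8 of \<epsilon>.\<close>
        have "12 * l * (\<epsilon> / (16 * R * l)) \<le> \<epsilon> / 4"
          using l_pos pos \<epsilon> by (simp add: field_simps)
        moreover have "r * D \<le> \<epsilon> / 8" using r D by (simp add: field_simps)
        ultimately show "12 * l * (\<epsilon> / (16 * R * l)) + 2 * (c * norm (xs - z s)) + 2 * (r * diameter Y) \<le> \<epsilon>"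
          using s(6) \<epsilon> unfolding D_def[symmetric] by linarith
      qed (use r0 c l_pos in auto)
      moreover have "B * (l * g / \<epsilon>\<^sup>2 * sqrt (l / r) * ln (1 / \<epsilon>))
        \<le> B / sqrt c\<^sub>1 * (l powr 1.5 * D powr 0.5 * g / \<epsilon> powr 2.5 * ln (1 / \<epsilon>))"
      proof -
        \<comment> \<open>The square root supplies the half powers of \<open>l\<close>,
          \<open>D\<close> and \<epsilon>.\<close>
        have "l / r \<le> l * D / (c\<^sub>1 * \<epsilon>)"
          using r(1) r0 l_pos D \<epsilon> pos by (simp add: field_simps)
        then have "sqrt (l / r) \<le> sqrt (l * D / (c\<^sub>1 * \<epsilon>))" by simp
        then have "B * (l * g / \<epsilon>\<^sup>2 * sqrt (l / r) * ln (1 / \<epsilon>))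
          \<le> B * (l * g / \<epsilon>\<^sup>2 * sqrt (l * D / (c\<^sub>1 * \<epsilon>)) * ln (1 / \<epsilon>))"
          using B \<epsilon> \<epsilon>\<^sub>0 order_trans[OF zero_le_power2 gap] by (intro mult_left_mono mult_right_mono) auto
        also have "\<dots> = B / sqrt c\<^sub>1 * (l powr 1.5 * D powr 0.5 * g / \<epsilon> powr 2.5 * ln (1 / \<epsilon>))"
          using powr_half_sqrt[of D] D
          by (simp add: powr_three_halves[OF l_pos] powr_five_halves[OF \<epsilon>(1)] real_sqrt_mult real_sqrt_divide mult_ac)
        finally show ?thesis .
      qed
      ultimately show ?case
        using steps unfolding ry g_def by (intro exI[of _ "Suc s"]) linarith
    next
      case H: (4 \<epsilon> foam steps c ry \<beta> \<delta> x y z r)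
      then have ry: "ry = (\<lambda>_. r)" by auto
      define g where "g = initial_gap c r f X Y z\<^sub>0"
      from H have \<epsilon>: "0 < \<epsilon>" "\<epsilon> < \<epsilon>\<^sub>0" and gap: "\<epsilon>\<^sup>2 \<le> l * g" and c: "3 * l < c"
        and r0: "0 < r" and r: "c\<^sub>1 * (\<epsilon>\<^sup>2 / (l * D\<^sup>2)) \<le> r" "r \<le> \<epsilon>\<^sup>2 / (l * D\<^sup>2) / 8"
        by (auto simp: ry g_def admissible_params_def)
      \<comment> \<open>The same comparison now supplies the upper bound for the smaller
        \<open>r\<close>.\<close>
      have "\<epsilon> / (l * D) * (\<epsilon> / D) \<le> 1 * (\<epsilon> / D)"
        using \<epsilon> \<epsilon>\<^sub>0 D l_pos by (intro mult_right_mono) auto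
      then have "\<epsilon>\<^sup>2 / (l * D\<^sup>2) / 8 \<le> \<epsilon> / (8 * D)"
        by (auto simp: power2_eq_square mult_ac)
      with r have r_up: "r \<le> \<epsilon> / (8 * D)" by linarith
      have "\<exists>s xs ys. sol c r (z s) xs ys \<and> x (Suc s) \<in> X \<and> y (Suc s) \<in> Y \<and>
        norm (x (Suc s) - xs) \<le> \<epsilon> / (16 * R * l) \<and> norm (y (Suc s) - ys) \<le> \<epsilon> / (16 * R * l) \<and>
        c * norm (xs - z s) \<le> \<epsilon> / 16 \<and>
        real (psfoam_steps steps f X Y l c (\<lambda>_. r) \<delta> x y z (Suc s) + 1)
          \<le> B * (l * initial_gap c r f X Y z\<^sub>0 / \<epsilon>\<^sup>2 * sqrt (l / r) * ln (1 / \<epsilon>))"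
        by (rule main[where foam=foam and \<beta>=\<beta>]) (use H r_up r in \<open>simp add: ry\<close>)
      then obtain s xs ys where s: "sol c r (z s) xs ys" "x (Suc s) \<in> X"
        "norm (x (Suc s) - xs) \<le> \<epsilon> / (16 * R * l)" "c * norm (xs - z s) \<le> \<epsilon> / 16"
        and steps: "real (psfoam_steps steps f X Y l c (\<lambda>_. r) \<delta> x y z (Suc s) + 1)
          \<le> B * (l * g / \<epsilon>\<^sup>2 * sqrt (l / r) * ln (1 / \<epsilon>))"
        unfolding g_def by blast
      have "opt_stationary f X Y l \<epsilon> (x (Suc s))"
      proof (rule opt_stationary_of_sol[OF s(1) _ _ s(2,3) _ \<epsilon>(1) s(4)])
        show "\<epsilon> / (16 * R * l) \<le> \<epsilon> / (8 * l)"
          using l_pos pos \<epsilon> by (intro divide_left_mono) auto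
        show "r * (diameter Y)\<^sup>2 \<le> \<epsilon>\<^sup>2 / (8 * l)"
          using r(2) D l_pos unfolding D_def[symmetric] by (simp add: field_simps)
      qed (use r0 c l_pos in auto)
      moreover have "B * (l * g / \<epsilon>\<^sup>2 * sqrt (l / r) * ln (1 / \<epsilon>))
        \<le> B / sqrt c\<^sub>1 * (l\<^sup>2 * D * g / \<epsilon> ^ 3 * ln (1 / \<epsilon>))"
      proof -
        \<comment> \<open>With \<open>r\<close> of order \<open>\<epsilon>\<^sup>2\<close> the ratio
          is bounded by a perfect square over \<open>c\<^sub>1\<close>, hence the integer powers in
          the final bound.\<close>
        have "l / r \<le> (l * D / \<epsilon>)\<^sup>2 / c\<^sub>1"
          using r(1) r0 l_pos D \<epsilon> pos by (simp add: field_simps power2_eq_square)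
        then have "sqrt (l / r) \<le> sqrt ((l * D / \<epsilon>)\<^sup>2 / c\<^sub>1)" by simp
        also have "\<dots> = l * D / \<epsilon> / sqrt c\<^sub>1"
          unfolding real_sqrt_divide real_sqrt_abs using l_pos D \<epsilon> by simp
        finally have "B * (l * g / \<epsilon>\<^sup>2 * sqrt (l / r) * ln (1 / \<epsilon>))
          \<le> B * (l * g / \<epsilon>\<^sup>2 * (l * D / \<epsilon> / sqrt c\<^sub>1) * ln (1 / \<epsilon>))"
          using B \<epsilon> \<epsilon>\<^sub>0 order_trans[OF zero_le_power2 gap] by (intro mult_left_mono mult_right_mono) auto
        also have "\<dots> = B / sqrt c\<^sub>1 * (l\<^sup>2 * D * g / \<epsilon> ^ 3 * ln (1 / \<epsilon>))"
          by (simp add: power2_eq_square power3_eq_cube mult_ac)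
        finally show ?thesis .
      qed
      ultimately show ?case
        using steps unfolding ry g_def by (intro exI[of _ "Suc s"]) linarith
    qed (use \<epsilon>\<^sub>0 in auto)
  qed (use B pos in simp)
qed simp

end
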